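(* Let $c,\sigma\in\mathbb{R}$, let $N\in\{0,1,2,\dots\}\cup\{\infty\}$, let $\{x_j\}_{j=1}^N\subset\mathbb{R}\setminus\{0\}$ be a multiset with $\sum_{j=1}^N x_j^{-2}<\infty$, and let $$f(z)=e^{cz-\frac{\sigma^2}{2}z^2}\prod_{j=1}^N\Big(1-\frac{z}{x_j}\Big)e^{z/x_j}.$$ For $d\ge 1$ let $\hat A_d(z)=f\big(\tfrac{D}{d}\big)^d z^d$, where $D=\frac{d}{dz}$. Then, as $d\to\infty$, the empirical root measures $\mu_{\hat A_d}$ converge weakly to the $\boxplus$-infinitely divisible distribution $\mu_f$ whose $R$-transform is $$R_{\mu_f}(z)=\gamma+\sigma^2 z+\int_{\mathbb{R}}\frac{z+t}{1-zt}\,\frac{t^2}{t^2+1}\,d\nu_f(t),$$ where $\nu_f=\sum_{j=1}^N\delta_{1/x_j}$ and $\gamma=-c-\sum_{j=1}^N\frac{1}{x_j^3+x_j}$.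
   Context: For a degree $d$ polynomial $p$ with real roots $y_1,\dots,y_d$ (with multiplicity), its empirical root measure is $\mu_p=\frac1d\sum_{j=1}^d\delta_{y_j}$. For a power series $h(z)=\sum_k h_k z^k$, $h(D/d)$ acts on polynomials by $\sum_k h_k d^{-k}D^k$ (a finite sum on each polynomial), and $f(D/d)^d$ is the $d$-fold composition of $f(D/d)$. The polynomials $\hat A_d$ have only real roots. $R$-transform: for a probability measure $\nu$ on $\mathbb{R}$, let $G_\nu(z)=\int\frac{1}{z-t}d\nu(t)$, $z\in\mathbb{C}^+$. For $\alpha,\beta>0$ let $\Gamma_{\alpha,\beta}=\{z:\alpha\,\mathrm{Im}\,z>|\mathrm{Re}\,z|,\ \mathrm{Im}\,z>\beta\}$ and $\Delta_{\alpha,\beta}=\{z:z^{-1}\in\Gamma_{\alpha,\beta}\}$. For every $\alpha>0$ there is $\beta>0$ such that there is an analytic function $R_\nu$ on $\Delta_{\alpha,\beta}$ with $G_\nu(R_\nu(z)+1/z)=z$ on $\Delta_{\alpha,\beta}$ and $R_\nu(G_\nu(z))+1/G_\nu(z)=z$ on $\Gamma_{\alpha,\beta}$; $R_\nu$ is the $R$-transform of $\nu$. The free additive convolution $\nu\boxplus\mu$ is the unique probability measure with $R_{\nu\boxplus\mu}=R_\nu+R_\mu$. A probability measure $\nu$ is $\boxplus$-infinitely divisible if for every $n\in\mathbb{N}$ there is a probability measure $\nu_n$ with $\nu_n^{\boxplus n}=\nu$. *)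

theory Defs
  imports "HOL-Probability.Probability" "HOL-Complex_Analysis.Complex_Analysis"
begin

definition index_set :: "enat \<Rightarrow> nat set" where
  "index_set N = {j. 1 \<le> j \<and> enat j \<le> N}"

definition lp_function :: "real \<Rightarrow> real \<Rightarrow> enat \<Rightarrow> (nat \<Rightarrow> real) \<Rightarrow> complex \<Rightarrow> complex" where
  "lp_function c \<sigma> N x z =
     exp (of_real c * z - of_real (\<sigma>\<^sup>2 / 2) * z\<^sup>2) *
     prodinf (\<lambda>j. if j \<in> index_set N
                  then (1 - z / of_real (x j)) * exp (z / of_real (x j)) else 1)"

text \<open>The operator \<open>h(D/d)\<close> on polynomials; terms with \<open>k > degree p\<close> vanish.\<close>

definition diff_op :: "complex fps \<Rightarrow> nat \<Rightarrow> complex poly \<Rightarrow> complex poly" where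
  "diff_op h d p =
     (\<Sum>k\<le>degree p. smult (fps_nth h k / of_nat d ^ k) ((pderiv ^^ k) p))"

definition A_hat :: "(complex \<Rightarrow> complex) \<Rightarrow> nat \<Rightarrow> complex poly" where
  "A_hat f d = (diff_op (fps_expansion f 0) d ^^ d) (monom 1 d)"

text \<open>The atoms are the real roots, weighted by multiplicity over the degree. For nonconstant \<open>p\<close> the total
  mass is 1 exactly when all roots are real; nonreal roots would show up as missing mass.\<close>

definition empirical_root_measure :: "complex poly \<Rightarrow> real measure" where
  "empirical_root_measure p =
     distr (point_measure {y::real. poly p (of_real y) = 0}
              (\<lambda>y. ennreal (real (order (of_real y) p) / real (degree p))))
           borel (\<lambda>y. y)"

definition Cauchy_transform :: "real measure \<Rightarrow> complex \<Rightarrow> complex" where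
  "Cauchy_transform \<nu> z = (LINT t|\<nu>. 1 / (z - of_real t))"

definition Gamma_region :: "real \<Rightarrow> real \<Rightarrow> complex set" where
  "Gamma_region \<alpha> \<beta> = {z. \<alpha> * Im z > \<bar>Re z\<bar> \<and> Im z > \<beta>}"

definition Delta_region :: "real \<Rightarrow> real \<Rightarrow> complex set" where
  "Delta_region \<alpha> \<beta> = {z. inverse z \<in> Gamma_region \<alpha> \<beta>}"

text \<open>A relation rather than a function, since the domain of an \<open>R\<close>-transform depends on the
  measure: \<open>R\<close> is meaningful on the union over \<open>\<alpha>\<close> of the regions \<open>\<Delta>\<close> below, and its values
  elsewhere are irrelevant. The condition on \<open>Im\<close> says that the argument of the Cauchy transform
  lies in its domain, the upper half plane.\<close>

definition has_R_transform :: "real measure \<Rightarrow> (complex \<Rightarrow> complex) \<Rightarrow> bool" where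
  "has_R_transform \<nu> R \<longleftrightarrow>
     (\<forall>\<alpha>>0. \<exists>\<beta>>0.
        R analytic_on Delta_region \<alpha> \<beta> \<and>
        (\<forall>z\<in>Delta_region \<alpha> \<beta>.
           Im (R z + 1 / z) > 0 \<and> Cauchy_transform \<nu> (R z + 1 / z) = z) \<and>
        (\<forall>z\<in>Gamma_region \<alpha> \<beta>.
           R (Cauchy_transform \<nu> z) + 1 / Cauchy_transform \<nu> z = z))"

definition free_conv :: "real measure \<Rightarrow> real measure \<Rightarrow> real measure" where
  "free_conv \<nu> \<mu> =
     (THE \<rho>. real_distribution \<rho> \<and>
        (\<exists>R S. has_R_transform \<nu> R \<and> has_R_transform \<mu> S \<and>
               has_R_transform \<rho> (\<lambda>z. R z + S z)))"

text \<open>The \<open>n\<close>-fold free convolution power is formed by \<open>n - 1\<close> convolutions, for \<open>n \<ge> 1\<close>.\<close>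

definition free_conv_power :: "real measure \<Rightarrow> nat \<Rightarrow> real measure" where
  "free_conv_power \<nu> n = (free_conv \<nu> ^^ (n - 1)) \<nu>"

definition freely_infinitely_divisible :: "real measure \<Rightarrow> bool" where
  "freely_infinitely_divisible \<nu> \<longleftrightarrow> real_distribution \<nu> \<and>
     (\<forall>n\<ge>1. \<exists>\<nu>n. real_distribution \<nu>n \<and> free_conv_power \<nu>n n = \<nu>)"

text \<open>The sum of the unit masses at the points \<open>1 / x j\<close>, as a push-forward of counting measure.\<close>

definition reciprocal_measure :: "enat \<Rightarrow> (nat \<Rightarrow> real) \<Rightarrow> real measure" where
  "reciprocal_measure N x = distr (count_space (index_set N)) borel (\<lambda>j. 1 / x j)"

definition drift :: "real \<Rightarrow> enat \<Rightarrow> (nat \<Rightarrow> real) \<Rightarrow> real" where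
  "drift c N x = - c - (\<Sum>\<^sub>\<infinity>j\<in>index_set N. 1 / (x j ^ 3 + x j))"

end

theory Submission
  imports Defs "HOL-Computational_Algebra.Fundamental_Theorem_Algebra"
begin

text \<open>Near \<open>0\<close> write \<open>R = - f' / f = \<Sum>r\<^sub>j w\<^sup>j\<close>. The logarithmic derivative of the product shows that \<open>R\<close> is the
function in the conclusion, so the task is to find a measure with \<open>R\<close>-transform \<open>R\<close> as the limit of the root
measures. All of it follows from one recurrence.

Fix \<open>n\<close> and \<open>m \<le> n\<close>, put \<open>\<theta> = m / n\<close> and \<open>a\<^sub>k = f(D/n)\<^sup>m z\<^sup>k\<close>. The exponential generating function of
\<open>a\<^sub>0, a\<^sub>1, \<dots>\<close> is \<open>f(w/n)\<^sup>m e\<^bsup>zw\<^esup>\<close>; its derivative in \<open>w\<close> gives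
\<open>a\<^bsub>k+1\<^esub> = z a\<^sub>k - \<theta> \<Sum>\<^sub>j r\<^sub>j (k (k-1) \<dots> (k-j+1) / n\<^sup>j) a\<^bsub>k-j\<^esub>\<close>, and its derivative in \<open>z\<close> gives \<open>a\<^sub>k' = k a\<^bsub>k-1\<^esub>\<close>.
Hence the ratios \<open>u\<^sub>k = a\<^sub>k / a\<^bsub>k+1\<^esub>\<close> solve a perturbation of \<open>1/U = z - \<theta> R(U)\<close>: in \<open>1/u\<^sub>k\<close>, a product of
\<open>j\<close> earlier ratios, with a factor that tends to \<open>1\<close> as \<open>k\<close> approaches \<open>n\<close>, takes the place of \<open>U\<^sup>j\<close>. For
large \<open>|z|\<close> the equation is a contraction near \<open>0\<close>, and induction on \<open>k\<close> gives \<open>a\<^bsub>k+1\<^esub>(z) \<noteq> 0\<close> together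
with \<open>|u\<^sub>k - U| \<le> (n - k) / n\<close> (\<open>ratio_estimate\<close>). But \<open>u\<^bsub>n-1\<^esub> = a\<^sub>n' / (n a\<^sub>n)\<close> is the Cauchy transform of
the root measure of \<open>a\<^sub>n\<close>. So the roots lie in a disc that does not depend on \<open>n\<close>, the measures are tight,
and their Cauchy transforms are within \<open>1/n\<close> of \<open>U(z)\<close>. A probability measure is determined by its
Cauchy transform on an open set, so the root measures converge weakly (\<open>exists_weak_limit\<close>). The
equation for \<open>U\<close> says precisely that the limit has \<open>R\<close>-transform \<open>\<theta> R\<close>.

The root measures are probability measures because \<open>f(D/n)\<close> preserves real-rootedness. The operators
\<open>1 - a D\<close> do, and so do coefficientwise limits of products of such operators, since a polynomial
with real roots satisfies \<open>|p(z)| \<ge> |lc p| |Im z|\<^bsup>deg p\<^esup>\<close>. The series \<open>f\<close> is such a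
limit, because its exponential and Gaussian factors are limits of products of real linear factors.

The parameter \<open>\<theta>\<close> yields infinite divisibility: the limits for \<open>\<theta> = k/q\<close>, \<open>k = 1, \<dots>, q\<close>, are successive
free convolution powers of the first one (\<open>free_conv_solves_fixpoint\<close>).\<close>

section \<open>Differential operators given by power series\<close>

lemma degree_pderiv_funpow: "degree ((pderiv ^^ k) (p :: complex poly)) = degree p - k"
  by (induction k) (auto simp: degree_pderiv)

lemma pderiv_funpow_eq_0:
  assumes "degree (p :: complex poly) < k"
  shows "(pderiv ^^ k) p = 0"
proof -
  define m where "m = k - Suc (degree p)"
  have k: "k = m + Suc (degree p)" using assms by (simp add: m_def)
  have "degree ((pderiv ^^ degree p) p) = 0" by (simp add: degree_pderiv_funpow)
  then have "pderiv ((pderiv ^^ degree p) p) = 0" by (simp add: pderiv_eq_0_iff)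
  moreover have "(pderiv ^^ m) 0 = (0 :: complex poly)" by (induction m) auto
  ultimately show ?thesis unfolding k funpow_add by simp
qed

lemma diff_op_eq_sum:
  assumes "degree p \<le> N"
  shows "diff_op h d p = (\<Sum>k\<le>N. smult (fps_nth h k / of_nat d ^ k) ((pderiv ^^ k) p))"
  unfolding diff_op_def
  by (rule sum.mono_neutral_left) (use assms pderiv_funpow_eq_0 in auto)

lemma pderiv_funpow_smult: "(pderiv ^^ k) (smult c p) = smult c ((pderiv ^^ k) p)"
  for p :: "complex poly"
  by (induction k) (auto simp: pderiv_smult)

lemma pderiv_funpow_sum: "(pderiv ^^ k) (\<Sum>i\<in>A. f i) = (\<Sum>i\<in>A. (pderiv ^^ k) (f i))"
  for f :: "'a \<Rightarrow> complex poly"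
proof (induction k)
  case (Suc k)
  have "pderiv (\<Sum>i\<in>A. g i) = (\<Sum>i\<in>A. pderiv (g i))" for g :: "'a \<Rightarrow> complex poly"
    by (induction A rule: infinite_finite_induct) (auto simp: pderiv_add)
  with Suc show ?case by simp
qed auto

lemma degree_diff_op_le: "degree (diff_op h d p) \<le> degree p"
  unfolding diff_op_def by (rule Polynomial.degree_sum_le) (auto simp: degree_pderiv_funpow)

lemma smult_sum_right: "smult c (\<Sum>i\<in>A. f i) = (\<Sum>i\<in>A. smult c (f i))"
  for c :: complex
  by (induction A rule: infinite_finite_induct) (auto simp: smult_add_right)

text \<open>Beyond the degree all terms vanish, so both operators can be truncated at the same order and the
  product becomes a Cauchy product.\<close>

lemma diff_op_mult: "diff_op g d (diff_op h d p) = diff_op (g * h) d p"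
proof -
  define N where "N = degree p"
  define c where "c i j = fps_nth g i * fps_nth h j / of_nat d ^ (i + j)" for i j
  have "degree (diff_op h d p) \<le> N" by (simp add: N_def degree_diff_op_le)
  then have "diff_op g d (diff_op h d p)
      = (\<Sum>i\<le>N. \<Sum>j\<le>N. smult (c i j) ((pderiv ^^ (i + j)) p))"
    by (subst diff_op_eq_sum[of "diff_op h d p" N], assumption)
       (auto simp: N_def diff_op_eq_sum[OF order_refl, of h d p]
          pderiv_funpow_sum pderiv_funpow_smult smult_sum_right c_def power_add funpow_add)
  also have "\<dots> = (\<Sum>i\<le>N. \<Sum>j\<le>N - i. smult (c i j) ((pderiv ^^ (i + j)) p))"
    by (intro sum.cong sum.mono_neutral_right refl) (auto simp: N_def pderiv_funpow_eq_0)
  also have "\<dots> = (\<Sum>(i,j)\<in>{(i,j). i + j \<le> N}. smult (c i j) ((pderiv ^^ (i + j)) p))"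
    by (subst sum.Sigma) (auto intro!: sum.cong)
  also have "\<dots> = (\<Sum>k\<le>N. \<Sum>i\<le>k. smult (c i (k - i)) ((pderiv ^^ k) p))"
    by (subst sum.triangle_reindex_eq) (auto intro!: sum.cong)
  also have "\<dots> = diff_op (g * h) d p"
    by (subst diff_op_eq_sum[of _ N])
       (auto simp: N_def fps_mult_nth c_def smult_sum sum_divide_distrib atLeast0AtMost
          intro!: sum.cong)
  finally show ?thesis .
qed

lemma diff_op_one: "diff_op 1 d p = p"
  by (subst diff_op_eq_sum[OF order_refl], subst sum.remove[of _ 0]) auto

lemma diff_op_funpow: "(diff_op h d ^^ m) p = diff_op (h ^ m) d p"
  by (induction m) (auto simp: diff_op_one diff_op_mult)

lemma lead_coeff_diff_op:
  assumes "fps_nth h 0 = 1"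
  shows "coeff (diff_op h d p) (degree p) = lead_coeff p"
proof -
  have "coeff ((pderiv ^^ k) p) (degree p) = 0" if "k > 0" "k \<le> degree p" for k
    by (rule coeff_eq_0) (use that in \<open>auto simp: degree_pderiv_funpow\<close>)
  then show ?thesis
    unfolding diff_op_def coeff_sum
    by (subst sum.remove[of _ 0]) (auto simp: assms intro!: sum.neutral)
qed

lemma degree_diff_op:
  assumes "fps_nth h 0 = 1"
  shows "degree (diff_op h d p) = degree p"
proof (cases "p = 0")
  case True
  then show ?thesis using degree_diff_op_le[of h d p] by simp
next
  case False
  then have "coeff (diff_op h d p) (degree p) \<noteq> 0" by (simp add: lead_coeff_diff_op[OF assms])
  then show ?thesis by (intro antisym degree_diff_op_le le_degree)
qed

section \<open>Real-rootedness preserving operators\<close>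

definition real_rooted :: "complex poly \<Rightarrow> bool" where
  "real_rooted p \<longleftrightarrow> p \<noteq> 0 \<and> (\<forall>z. poly p z = 0 \<longrightarrow> Im z = 0)"

text \<open>Each linear factor satisfies \<open>|z - y| \<ge> |Im z|\<close>. The bound depends only on the degree and the leading
  coefficient, so it survives limits in which these are fixed; it replaces Hurwitz's theorem.\<close>

lemma real_rooted_norm_ge:
  assumes "real_rooted p"
  shows "norm (poly p z) \<ge> norm (lead_coeff p) * \<bar>Im z\<bar> ^ degree p"
proof -
  have aux: "\<bar>Im z\<bar> ^ size A \<le> norm (poly (\<Prod>x\<in>#A. [:-x, 1:]) z)"
    if "\<forall>x\<in>#A. Im x = 0" for A
    using that
  proof (induction A)
    case (add x A)
    have "\<bar>Im z\<bar> \<le> norm (z - x)"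
      using add.prems abs_Im_le_cmod[of "z - x"] by auto
    then have "\<bar>Im z\<bar> * \<bar>Im z\<bar> ^ size A
        \<le> norm (z - x) * norm (poly (\<Prod>x\<in>#A. [:-x, 1:]) z)"
      using add by (intro mult_mono) auto
    then show ?case
      unfolding image_mset_add_mset prod_mset.add_mset poly_mult by (simp add: norm_mult)
  qed auto
  have "\<bar>Im z\<bar> ^ degree p \<le> norm (poly (\<Prod>x\<in>#proots p. [:-x, 1:]) z)"
    using aux[of "proots p"] assms by (auto simp: real_rooted_def size_proots_complex)
  then have "norm (lead_coeff p) * \<bar>Im z\<bar> ^ degree p
      \<le> norm (poly (smult (lead_coeff p) (\<Prod>x\<in>#proots p. [:-x, 1:])) z)"
    by (auto simp: norm_mult intro!: mult_left_mono)
  then show ?thesis by (simp only: complex_poly_decompose_multiset)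
qed

lemma sum_mset_image_eq_sum_count:
  fixes f :: "'a \<Rightarrow> 'b :: comm_ring_1"
  assumes "finite S" "set_mset A \<subseteq> S"
  shows "(\<Sum>x\<in>#A. f x) = (\<Sum>x\<in>S. of_nat (count A x) * f x)"
  using assms(2)
proof (induction A)
  case (add x A)
  have "(\<Sum>y\<in>S. of_nat (count (add_mset x A) y) * f y)
      = (\<Sum>y\<in>S. of_nat (count A y) * f y + (if y = x then f x else 0))"
    by (intro sum.cong) (auto simp: algebra_simps)
  then show ?case using add assms(1) by (simp add: sum.distrib sum.delta)
qed auto

lemma poly_pderiv_eq_sum_roots:
  fixes p :: "complex poly"
  assumes "p \<noteq> 0" "poly p z \<noteq> 0"
  shows "poly (pderiv p) z / poly p z = (\<Sum>y | poly p y = 0. of_nat (order y p) / (z - y))"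
proof -
  have aux: "poly (pderiv (\<Prod>x\<in>#A. [:-x, 1:])) z
      = poly (\<Prod>x\<in>#A. [:-x, 1:]) z * (\<Sum>x\<in>#A. 1 / (z - x))" if "z \<notin># A" for A
    using that
  proof (induction A)
    case (add x A)
    define q where "q = (\<Prod>x\<in>#A. [:-x, 1:])"
    have "poly (pderiv ([:-x, 1:] * q)) z = poly q z + (z - x) * poly (pderiv q) z"
      unfolding pderiv_mult by (simp add: pderiv_pCons algebra_simps)
    then show ?case
      using add unfolding image_mset_add_mset prod_mset.add_mset sum_mset.add_mset q_def[symmetric]
      by (simp add: ring_distribs) (simp add: field_simps)
  qed auto
  have nz: "z \<notin># proots p" using assms by auto
  define c q where "c = lead_coeff p" and "q = (\<Prod>x\<in>#proots p. [:-x, 1:])"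
  have p: "p = smult c q" unfolding c_def q_def by (rule complex_poly_decompose_multiset[symmetric])
  have "pderiv p = smult c (pderiv q)" by (subst p) (rule pderiv_smult)
  moreover have "poly p z = c * poly q z" by (subst p) (rule poly_smult)
  ultimately have "poly (pderiv p) z = poly p z * (\<Sum>x\<in>#proots p. 1 / (z - x))"
    using aux[OF nz] by (simp add: q_def)
  also have "(\<Sum>x\<in>#proots p. 1 / (z - x)) = (\<Sum>y | poly p y = 0. of_nat (order y p) / (z - y))"
    using assms by (subst sum_mset_image_eq_sum_count[of "{y. poly p y = 0}"])
      (auto simp: poly_roots_finite)
  finally show ?thesis using assms by simp
qed

text \<open>The normalisation \<open>h(0) = 1\<close> makes \<open>h(D/d)\<close> keep the degree and the leading coefficient.\<close>

definition preserves_real_roots :: "complex fps \<Rightarrow> bool" where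
  "preserves_real_roots h \<longleftrightarrow> fps_nth h 0 = 1 \<and>
     (\<forall>d p. d > 0 \<longrightarrow> real_rooted p \<longrightarrow> real_rooted (diff_op h d p))"

lemma preserves_real_roots_mult:
  assumes "preserves_real_roots g" "preserves_real_roots h"
  shows "preserves_real_roots (g * h)"
  using assms by (auto simp: preserves_real_roots_def simp flip: diff_op_mult)

lemma preserves_real_roots_one: "preserves_real_roots 1"
  by (auto simp: preserves_real_roots_def diff_op_one)

lemma preserves_real_roots_power:
  "preserves_real_roots g \<Longrightarrow> preserves_real_roots (g ^ n)"
  by (induction n) (auto simp: preserves_real_roots_mult preserves_real_roots_one)

lemma preserves_real_roots_prod:
  "(\<And>i. i \<in> A \<Longrightarrow> preserves_real_roots (g i)) \<Longrightarrow> preserves_real_roots (\<Prod>i\<in>A. g i)"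
  by (induction A rule: infinite_finite_induct)
     (auto simp: preserves_real_roots_mult preserves_real_roots_one)

lemma preserves_real_roots_limit:
  assumes pres: "\<And>n. preserves_real_roots (h n)"
    and lim: "\<And>k. (\<lambda>n. fps_nth (h n) k) \<longlonglongrightarrow> fps_nth g k"
  shows "preserves_real_roots g"
proof -
  have h0: "fps_nth (h n) 0 = 1" for n
    using pres by (auto simp: preserves_real_roots_def)
  have g0: "fps_nth g 0 = 1"
    using lim[of 0] by (simp add: h0 LIMSEQ_const_iff)
  have "real_rooted (diff_op g d p)" if "d > 0" and p: "real_rooted p" for d p
  proof -
    have ge: "norm (lead_coeff p) * \<bar>Im z\<bar> ^ degree p \<le> norm (poly (diff_op g d p) z)" for z
    proof (rule LIMSEQ_le_const)
      show "(\<lambda>n. norm (poly (diff_op (h n) d p) z)) \<longlonglongrightarrow> norm (poly (diff_op g d p) z)"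
        unfolding diff_op_def poly_sum poly_smult
        by (intro tendsto_intros lim) (use \<open>d > 0\<close> in auto)
      show "\<exists>N. \<forall>n\<ge>N. norm (lead_coeff p) * \<bar>Im z\<bar> ^ degree p
          \<le> norm (poly (diff_op (h n) d p) z)"
        using real_rooted_norm_ge[of "diff_op (h _) d p" z] pres that
        by (auto simp: preserves_real_roots_def degree_diff_op lead_coeff_diff_op)
    qed
    have "p \<noteq> 0" using p by (auto simp: real_rooted_def)
    then have pos: "norm (lead_coeff p) * \<bar>Im z\<bar> ^ degree p > 0" if "Im z \<noteq> 0" for z
      using that by auto
    show ?thesis
      unfolding real_rooted_def
    proof (intro conjI allI impI)
      show "diff_op g d p \<noteq> 0" using ge[of \<i>] pos[of \<i>] by auto
      show "Im z = 0" if "poly (diff_op g d p) z = 0" for z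
        using ge[of z] pos[of z] that by auto
    qed
  qed
  with g0 show ?thesis by (auto simp: preserves_real_roots_def)
qed

text \<open>A nonreal root \<open>z\<close> would satisfy \<open>b p'(z) / p(z) = 1\<close>. But \<open>p' / p = \<Sum>1 / (z - y)\<close> over the real roots
  \<open>y\<close>, and every summand has imaginary part of the sign opposite to \<open>Im z\<close>.\<close>

lemma real_rooted_minus_pderiv:
  assumes "real_rooted p"
  shows "real_rooted (p - smult (of_real b) (pderiv p))"
proof -
  have nz: "poly (p - smult (of_real b) (pderiv p)) z \<noteq> 0" if z: "Im z \<noteq> 0" for z
  proof
    assume eq: "poly (p - smult (of_real b) (pderiv p)) z = 0"
    have pz: "p \<noteq> 0" "poly p z \<noteq> 0" using assms z by (auto simp: real_rooted_def)
    define Y where "Y = {y. poly p y = 0}"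
    have fin: "finite Y" unfolding Y_def using pz poly_roots_finite by blast
    have real: "Im y = 0" if "y \<in> Y" for y using assms that by (auto simp: real_rooted_def Y_def)
    have one: "of_real b * (\<Sum>y\<in>Y. of_nat (order y p) / (z - y)) = 1"
      using eq poly_pderiv_eq_sum_roots[OF pz] pz unfolding Y_def
      by (auto simp: field_simps)
    define S where "S = (\<Sum>y\<in>Y. real (order y p) / (norm (z - y))\<^sup>2)"
    have "Im (of_nat (order y p) / (z - y)) = - Im z * (real (order y p) / (norm (z - y))\<^sup>2)"
      if "y \<in> Y" for y
      using real[OF that] by (simp add: Im_divide cmod_power2)
    then have "Im (\<Sum>y\<in>Y. of_nat (order y p) / (z - y)) = - Im z * S"
      unfolding S_def by (simp add: sum_distrib_left)
    then have "b * (- Im z * S) = Im 1"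
      by (subst one[symmetric]) (simp add: Im_sum)
    then have "b = 0 \<or> S = 0" using z by auto
    moreover have "S = 0 \<Longrightarrow> (\<Sum>y\<in>Y. of_nat (order y p) / (z - y)) = 0"
      unfolding S_def by (subst (asm) sum_nonneg_eq_0_iff) (auto simp: fin intro!: sum.neutral)
    ultimately show False using one by auto
  qed
  have "p - smult (of_real b) (pderiv p) \<noteq> 0"
  proof
    assume "p - smult (of_real b) (pderiv p) = 0"
    then have "poly (p - smult (of_real b) (pderiv p)) \<i> = 0" by (simp only: poly_0)
    moreover have "Im \<i> \<noteq> 0" by simp
    ultimately show False using nz by blast
  qed
  then show ?thesis
    unfolding real_rooted_def using nz by blast
qed

lemma preserves_real_roots_linear:
  "preserves_real_roots (1 - fps_const (of_real a) * fps_X)"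
proof -
  define h :: "complex fps" where "h = 1 - fps_const (of_real a) * fps_X"
  have h: "fps_nth h k = (if k = 0 then 1 else if k = 1 then - of_real a else 0)" for k
    by (auto simp: h_def)
  have "diff_op h d p = p - smult (of_real (a / real d)) (pderiv p)" for d p
  proof -
    have "diff_op h d p = (\<Sum>k\<in>{0,1}. smult (fps_nth h k / of_nat d ^ k) ((pderiv ^^ k) p))"
      by (subst diff_op_eq_sum[of p "Suc (degree p)"], simp)
         (rule sum.mono_neutral_right, auto simp: h)
    then show ?thesis by (simp add: h)
  qed
  then show ?thesis
    using real_rooted_minus_pderiv
    unfolding preserves_real_roots_def h_def[symmetric] by (simp add: h del: of_real_divide)
qed

section \<open>Power series with a given logarithmic derivative\<close>

text \<open>The equation \<open>- h' / h = R\<close> without division, a form in which it passes to coefficientwise limits.\<close>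

definition neg_log_deriv :: "complex fps \<Rightarrow> complex fps \<Rightarrow> bool" where
  "neg_log_deriv h R \<longleftrightarrow> fps_nth h 0 = 1 \<and> fps_deriv h = - (R * h)"

lemma neg_log_deriv_one: "neg_log_deriv 1 0"
  by (simp add: neg_log_deriv_def)

lemma neg_log_deriv_mult:
  "neg_log_deriv g Q \<Longrightarrow> neg_log_deriv h R \<Longrightarrow> neg_log_deriv (g * h) (Q + R)"
  by (simp add: neg_log_deriv_def algebra_simps)

lemma neg_log_deriv_power: "neg_log_deriv h R \<Longrightarrow> neg_log_deriv (h ^ n) (of_nat n * R)"
  by (induction n) (auto simp: neg_log_deriv_one algebra_simps dest: neg_log_deriv_mult)

lemma neg_log_deriv_prod:
  "(\<And>i. i \<in> A \<Longrightarrow> neg_log_deriv (h i) (R i)) \<Longrightarrow>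
     neg_log_deriv (\<Prod>i\<in>A. h i) (\<Sum>i\<in>A. R i)"
  by (induction A rule: infinite_finite_induct) (auto simp: neg_log_deriv_one neg_log_deriv_mult)

lemma neg_log_deriv_linear:
  "neg_log_deriv (1 - fps_const a * fps_X) (Abs_fps (\<lambda>k. a ^ (k + 1)))"
proof -
  define S where "S = Abs_fps (\<lambda>k. a ^ (k + 1))"
  have "S - fps_const a * (fps_X * S) = fps_const a"
    by (rule fps_ext, rename_tac n, case_tac n) (auto simp: S_def)
  then have "S * (1 - fps_const a * fps_X) = fps_const a"
    by (simp add: algebra_simps)
  then show ?thesis by (simp add: neg_log_deriv_def S_def)
qed

lemma neg_log_deriv_exp: "neg_log_deriv (fps_exp c) (fps_const (- c))"
  by (simp add: neg_log_deriv_def flip: fps_const_neg)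

lemma neg_log_deriv_gauss:
  "neg_log_deriv (fps_exp 1 oo (fps_const (- s) * fps_X\<^sup>2)) (fps_const (2 * s) * fps_X)"
proof -
  have "fps_deriv (fps_X\<^sup>2) = (2 * fps_X :: complex fps)"
    by (simp add: power2_eq_square)
  then show ?thesis
    unfolding neg_log_deriv_def
    by (subst fps_compose_deriv) (auto simp: power2_eq_square simp flip: fps_const_neg)
qed

lemma neg_log_deriv_nth_Suc:
  assumes "neg_log_deriv h R"
  shows "fps_nth h (Suc k) = - (\<Sum>i\<le>k. fps_nth R i * fps_nth h (k - i)) / of_nat (Suc k)"
proof -
  have "fps_nth (fps_deriv h) k = - fps_nth (R * h) k"
    using assms by (simp add: neg_log_deriv_def)
  then show ?thesis
    by (simp add: fps_mult_nth atLeast0AtMost field_simps del: of_nat_Suc)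
qed

text \<open>The equation \<open>h' = - R h\<close> is a recursion in which the coefficient of index \<open>k + 1\<close> of \<open>h\<close> is a polynomial in
  earlier coefficients of \<open>h\<close> and \<open>R\<close>.\<close>

lemma neg_log_deriv_continuous:
  assumes h: "\<And>n. neg_log_deriv (h n) (R n)" and g: "neg_log_deriv g Q"
    and lim: "\<And>k. (\<lambda>n. fps_nth (R n) k) \<longlonglongrightarrow> fps_nth Q k"
  shows "(\<lambda>n. fps_nth (h n) k) \<longlonglongrightarrow> fps_nth g k"
proof (induction k rule: less_induct)
  case (less k)
  show ?case
  proof (cases k)
    case 0
    then show ?thesis using h g by (simp add: neg_log_deriv_def)
  next
    case (Suc l)
    show ?thesis
      unfolding Suc neg_log_deriv_nth_Suc[OF h] neg_log_deriv_nth_Suc[OF g]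
      by (intro tendsto_intros lim less) (use Suc in \<open>auto simp del: of_nat_Suc\<close>)
  qed
qed

lemma neg_log_deriv_limit:
  assumes h: "\<And>n. neg_log_deriv (h n) (R n)"
    and limh: "\<And>k. (\<lambda>n. fps_nth (h n) k) \<longlonglongrightarrow> fps_nth g k"
    and limR: "\<And>k. (\<lambda>n. fps_nth (R n) k) \<longlonglongrightarrow> fps_nth Q k"
  shows "neg_log_deriv g Q"
proof -
  have "fps_nth g 0 = 1"
    using limh[of 0] h by (simp add: neg_log_deriv_def LIMSEQ_const_iff)
  moreover have "fps_nth (fps_deriv g) k = fps_nth (- (Q * g)) k" for k
  proof (rule LIMSEQ_unique)
    show "(\<lambda>n. fps_nth (fps_deriv (h n)) k) \<longlonglongrightarrow> fps_nth (fps_deriv g) k"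
      unfolding fps_deriv_nth by (intro tendsto_intros limh)
    have "fps_deriv (h n) = - (R n * h n)" for n using h by (simp add: neg_log_deriv_def)
    then show "(\<lambda>n. fps_nth (fps_deriv (h n)) k) \<longlonglongrightarrow> fps_nth (- (Q * g)) k"
      unfolding fps_neg_nth fps_mult_nth by (auto simp: fps_mult_nth intro!: tendsto_intros limh limR)
  qed
  ultimately show ?thesis by (simp add: neg_log_deriv_def fps_eq_iff)
qed

text \<open>The exponential is the limit of \<open>(1 + c X / n)\<^sup>n\<close>.\<close>

lemma preserves_real_roots_exp: "preserves_real_roots (fps_exp (of_real c))"
proof (rule preserves_real_roots_limit)
  define a where "a n = - c / real (Suc n)" for n
  define h :: "nat \<Rightarrow> complex fps" where "h n = (1 - fps_const (of_real (a n)) * fps_X) ^ Suc n" for n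
  show "preserves_real_roots (h n)" for n
    unfolding h_def by (intro preserves_real_roots_power preserves_real_roots_linear)
  have lim0: "(\<lambda>n. inverse (real (Suc n)) ^ k) \<longlonglongrightarrow> 0" if "k > 0" for k
    using tendsto_power[OF LIMSEQ_inverse_real_of_nat, of k] that by (simp add: power_0_left)
  show "(\<lambda>n. fps_nth (h n) k) \<longlonglongrightarrow> fps_nth (fps_exp (of_real c)) k" for k
  proof (rule neg_log_deriv_continuous[OF _ neg_log_deriv_exp])
    show "neg_log_deriv (h n) (of_nat (Suc n) * Abs_fps (\<lambda>k. of_real (a n) ^ (k + 1)))" for n
      unfolding h_def by (intro neg_log_deriv_power neg_log_deriv_linear)
    fix k
    have eq: "fps_nth (of_nat (Suc n) * Abs_fps (\<lambda>k. of_real (a n) ^ (k + 1))) k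
        = (of_real ((- c) ^ (k + 1) * inverse (real (Suc n)) ^ k) :: complex)" for n
    proof -
      have "real (Suc n) * a n ^ (k + 1) = (- c) ^ (k + 1) * inverse (real (Suc n)) ^ k"
        unfolding a_def power_divide by (simp add: field_simps del: of_nat_Suc)
      moreover have "fps_nth (of_nat (Suc n) * Abs_fps (\<lambda>k. of_real (a n) ^ (k + 1))) k
          = (of_real (real (Suc n) * a n ^ (k + 1)) :: complex)"
        unfolding fps_mult_of_nat_nth by (simp del: of_nat_Suc)
      ultimately show ?thesis by simp
    qed
    show "(\<lambda>n. fps_nth (of_nat (Suc n) * Abs_fps (\<lambda>k. of_real (a n) ^ (k + 1))) k)
        \<longlonglongrightarrow> fps_nth (fps_const (- complex_of_real c)) k"
    proof (cases "k = 0")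
      case False
      show ?thesis unfolding eq
        using tendsto_of_real[OF tendsto_mult_left[OF lim0[of k], of "(- c) ^ (k + 1)"], where 'a=complex] False by simp
    next
      case True
      then show ?thesis unfolding eq by simp
    qed
  qed
qed

text \<open>The Gaussian is the limit of \<open>(1 - s X\<^sup>2 / n)\<^sup>n\<close>, whose quadratic factor splits into the real linear
  factors \<open>1 \<mp> sqrt (s / n) X\<close>. On the logarithmic derivatives only the linear coefficient survives the limit.\<close>

lemma preserves_real_roots_gauss:
  assumes "s \<ge> 0"
  shows "preserves_real_roots (fps_exp 1 oo (fps_const (- of_real s) * fps_X\<^sup>2))"
proof (rule preserves_real_roots_limit)
  define a where "a n = sqrt (s / real (Suc n))" for n
  define h :: "nat \<Rightarrow> complex fps" where "h n = ((1 - fps_const (of_real (a n)) * fps_X)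
     * (1 - fps_const (of_real (- a n)) * fps_X)) ^ Suc n" for n
  define Q :: "nat \<Rightarrow> complex fps" where
    "Q n = of_nat (Suc n) * (Abs_fps (\<lambda>k. of_real (a n) ^ (k + 1))
       + Abs_fps (\<lambda>k. of_real (- a n) ^ (k + 1)))" for n
  show "preserves_real_roots (h n)" for n
    unfolding h_def
    by (intro preserves_real_roots_power preserves_real_roots_mult preserves_real_roots_linear)
  have Q: "fps_nth (Q n) k = of_real (real (Suc n) * (a n ^ (k + 1) * (1 + (-1) ^ (k + 1))))" for n k
    unfolding Q_def by (simp add: fps_mult_of_nat_nth power_minus[of "of_real (a n)"] algebra_simps)
  have sq: "real (Suc n) * (a n)\<^sup>2 = s" for n
    using assms by (simp add: a_def)
  have a0: "a \<longlonglongrightarrow> 0"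
    unfolding a_def using tendsto_real_sqrt[OF tendsto_mult_left[OF LIMSEQ_inverse_real_of_nat, of s]]
    by (simp add: divide_inverse)
  show "(\<lambda>n. fps_nth (h n) k) \<longlonglongrightarrow> fps_nth (fps_exp 1 oo (fps_const (- of_real s) * fps_X\<^sup>2)) k" for k
  proof (rule neg_log_deriv_continuous[OF _ neg_log_deriv_gauss])
    show "neg_log_deriv (h n) (Q n)" for n
      unfolding h_def Q_def
      by (intro neg_log_deriv_power neg_log_deriv_mult neg_log_deriv_linear)
    fix k
    consider "k = 0" | "k = 1" | l where "k = Suc (Suc l)" by (metis One_nat_def not0_implies_Suc)
    then show "(\<lambda>n. fps_nth (Q n) k) \<longlonglongrightarrow> fps_nth (fps_const (2 * of_real s) * fps_X) k"
    proof cases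
      case 1 then show ?thesis by (simp add: Q)
    next
      case 2
      have "fps_nth (Q n) 1 = of_real (2 * (real (Suc n) * (a n)\<^sup>2))" for n
        unfolding Q by (simp add: power2_eq_square)
      then show ?thesis using 2 unfolding sq by simp
    next
      case (3 l)
      have "fps_nth (Q n) k = of_real ((real (Suc n) * (a n)\<^sup>2) * (a n ^ Suc l * (1 + (-1) ^ (k + 1))))" for n
        unfolding Q 3 by (simp add: power2_eq_square)
      then have "fps_nth (Q n) k = of_real (s * (a n ^ Suc l * (1 + (-1) ^ (k + 1))))" for n
        unfolding sq .
      moreover have "(\<lambda>n. of_real (s * (a n ^ Suc l * (1 + (-1) ^ (k + 1)))) :: complex)
        \<longlonglongrightarrow> of_real (s * (0 ^ Suc l * (1 + (-1) ^ (k + 1))))"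
        by (intro tendsto_intros a0)
      ultimately show ?thesis using 3 by simp
    qed
  qed
qed

section \<open>The Appell recurrence\<close>

lemma pderiv_funpow_monom:
  "j \<le> k \<Longrightarrow> (pderiv ^^ j) (monom (1 :: complex) k) = monom (fact k / fact (k - j)) (k - j)"
proof (induction j)
  case (Suc j)
  then have "fact (k - j) = of_nat (k - j) * (fact (k - Suc j) :: complex)"
  proof -
    have kj: "k - j = Suc (k - Suc j)" using Suc.prems by simp
    show ?thesis unfolding kj by (rule fact_Suc)
  qed
  moreover have "of_nat (k - j) \<noteq> (0 :: complex)" using Suc.prems by (simp del: of_nat_diff)
  ultimately show ?case
    using Suc by (simp add: pderiv_monom field_simps del: of_nat_diff)
qed auto

text \<open>The polynomials \<open>h(D/n) z\<^sup>k\<close> are the coefficients of \<open>h(w/n) e\<^bsup>zw\<^esup>\<close>, up to the factor \<open>k!\<close>.\<close>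

lemma poly_diff_op_monom:
  "poly (diff_op h n (monom 1 k)) z
     = fact k * fps_nth (Abs_fps (\<lambda>j. fps_nth h j / of_nat n ^ j) * fps_exp z) k"
  by (subst diff_op_eq_sum[of _ k])
     (auto simp: degree_monom_eq poly_sum fps_mult_nth atLeast0AtMost sum_distrib_left
        pderiv_funpow_monom poly_monom intro!: sum.cong)

text \<open>Compare coefficients in \<open>\<partial>\<^sub>w (h(w/n) e\<^bsup>zw\<^esup>) = (z - R(w/n) / n) h(w/n) e\<^bsup>zw\<^esup>\<close>.\<close>

lemma diff_op_monom_recurrence:
  fixes n :: nat and z :: complex
  assumes "neg_log_deriv h R"
  defines "a \<equiv> \<lambda>k. poly (diff_op h n (monom 1 k)) z"
  shows "a (Suc k) = z * a k -
    (\<Sum>j\<le>k. fps_nth R j / of_nat n ^ Suc j * (fact k / fact (k - j)) * a (k - j))"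
proof -
  define hs where "hs = Abs_fps (\<lambda>j. fps_nth h j / of_nat n ^ j)"
  define Rs where "Rs = Abs_fps (\<lambda>j. fps_nth R j / of_nat n ^ Suc j)"
  define g where "g = hs * fps_exp z"
  have "fps_deriv hs = - (Rs * hs)"
  proof (rule fps_ext)
    fix k
    have "of_nat (Suc k) * fps_nth h (Suc k) = - (\<Sum>i\<le>k. fps_nth R i * fps_nth h (k - i))"
      using neg_log_deriv_nth_Suc[OF assms(1), of k] by (simp add: field_simps del: of_nat_Suc)
    then have "fps_nth (fps_deriv hs) k
        = - (\<Sum>i\<le>k. fps_nth R i * fps_nth h (k - i)) / of_nat n ^ Suc k"
      by (simp add: hs_def)
    also have "\<dots> = fps_nth (- (Rs * hs)) k"
    proof -
      have "fps_nth R i / of_nat n ^ Suc i * (fps_nth h (k - i) / of_nat n ^ (k - i))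
          = fps_nth R i * fps_nth h (k - i) / of_nat n ^ Suc k" if "i \<le> k" for i
        using that by (simp del: power_Suc flip: power_add)
      then have "(\<Sum>i\<le>k. fps_nth R i / of_nat n ^ Suc i * (fps_nth h (k - i) / of_nat n ^ (k - i)))
          = (\<Sum>i\<le>k. fps_nth R i * fps_nth h (k - i) / of_nat n ^ Suc k)"
        by (intro sum.cong) auto
      then show ?thesis
        unfolding hs_def Rs_def fps_neg_nth fps_mult_nth fps_nth_Abs_fps atLeast0AtMost
          sum_divide_distrib minus_divide_left[symmetric] by simp
    qed
    finally show "fps_nth (fps_deriv hs) k = fps_nth (- (Rs * hs)) k" .
  qed
  then have dg: "fps_deriv g = fps_const z * g - Rs * g"
    by (simp add: g_def algebra_simps)
  have a: "a k = fact k * fps_nth g k" for k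
    unfolding a_def g_def hs_def by (rule poly_diff_op_monom)
  have "a (Suc k) = fact k * fps_nth (fps_deriv g) k"
    unfolding a by (simp add: algebra_simps)
  also have "\<dots> = z * a k - (\<Sum>j\<le>k. fps_nth R j / of_nat n ^ Suc j * (fact k / fact (k - j)) * a (k - j))"
    unfolding dg a fps_sub_nth fps_mult_left_const_nth fps_mult_nth[of Rs g] atLeast0AtMost
    by (simp add: Rs_def right_diff_distrib sum_distrib_left mult_ac)
  finally show ?thesis .
qed

lemma pderiv_diff_op: "pderiv (diff_op h n p) = diff_op h n (pderiv p)"
proof -
  have *: "pderiv (\<Sum>i\<in>A. g i) = (\<Sum>i\<in>A. pderiv (g i))" for g :: "nat \<Rightarrow> complex poly" and A
    using pderiv_funpow_sum[of 1] by simp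
  have "degree (pderiv p) \<le> degree p" by (simp add: degree_pderiv)
  then show ?thesis
    by (simp add: diff_op_eq_sum[of _ "degree p"] * pderiv_smult funpow_swap1)
qed

lemma pderiv_diff_op_monom:
  "pderiv (diff_op h n (monom 1 (Suc k))) = smult (of_nat (Suc k)) (diff_op h n (monom 1 k))"
proof -
  have "pderiv (monom (1::complex) (Suc k)) = smult (of_nat (Suc k)) (monom 1 k)"
    by (simp add: pderiv_monom smult_monom)
  then show ?thesis
    by (simp add: pderiv_diff_op diff_op_eq_sum[of _ k] degree_monom_eq pderiv_funpow_smult
        smult_sum_right mult.commute del: of_nat_Suc)
qed

section \<open>The perturbed fixed point equation\<close>

text \<open>The telescoping estimate for a difference of products. It is multiplied by \<open>e\<close>, which turns
  the natural exponent \<open>j - 1\<close> on the right into \<open>j\<close> and makes the case \<open>j = 0\<close> unexceptional.\<close>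

lemma norm_prod_minus_power_le:
  fixes v :: "nat \<Rightarrow> complex"
  assumes "\<And>l. l < j \<Longrightarrow> norm (v l) \<le> e" "norm y \<le> e"
  shows "e * norm ((\<Prod>l<j. v l) - y ^ j) \<le> e ^ j * (\<Sum>l<j. norm (v l - y))"
  using assms(1)
proof (induction j)
  case (Suc j)
  have e: "e \<ge> 0" using assms(2) norm_ge_zero order_trans by blast
  have "(\<Prod>l<Suc j. v l) - y ^ Suc j = ((\<Prod>l<j. v l) - y ^ j) * v j + y ^ j * (v j - y)"
    by (simp add: algebra_simps)
  then have "norm ((\<Prod>l<Suc j. v l) - y ^ Suc j)
      \<le> norm ((\<Prod>l<j. v l) - y ^ j) * norm (v j) + norm y ^ j * norm (v j - y)"
    using norm_triangle_ineq[of "((\<Prod>l<j. v l) - y ^ j) * v j" "y ^ j * (v j - y)"]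
    by (simp only: norm_mult norm_power)
  then have "e * norm ((\<Prod>l<Suc j. v l) - y ^ Suc j)
      \<le> e * (norm ((\<Prod>l<j. v l) - y ^ j) * norm (v j) + norm y ^ j * norm (v j - y))"
    by (rule mult_left_mono[OF _ e])
  also have "\<dots> = (e * norm ((\<Prod>l<j. v l) - y ^ j)) * norm (v j) + e * norm y ^ j * norm (v j - y)"
    by (simp add: algebra_simps)
  also have "\<dots> \<le> (e ^ j * (\<Sum>l<j. norm (v l - y))) * e + e * e ^ j * norm (v j - y)"
  proof (rule add_mono)
    show "e * norm ((\<Prod>l<j. v l) - y ^ j) * norm (v j) \<le> e ^ j * (\<Sum>l<j. norm (v l - y)) * e"
      using Suc e by (intro mult_mono[of "e * _"]) (auto intro!: mult_nonneg_nonneg sum_nonneg)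
    show "e * norm y ^ j * norm (v j - y) \<le> e * e ^ j * norm (v j - y)"
      using e assms(2) by (intro mult_right_mono mult_left_mono power_mono) auto
  qed
  finally show ?case by (simp add: algebra_simps)
qed auto

text \<open>The series \<open>\<Sum>r\<^sub>j u\<^sup>j\<close> on the disc of radius \<open>\<epsilon>\<close>. The smallness conditions on \<open>\<epsilon>\<close> make the map
  \<open>u \<mapsto> 1 / (z - \<theta> \<Sum>r\<^sub>j u\<^sup>j)\<close> a contraction of that disc for \<open>|z| \<ge> 2 / \<epsilon>\<close> and \<open>\<theta> \<in> [0, 1]\<close>.\<close>

locale small_series =
  fixes r :: "nat \<Rightarrow> complex" and C B \<epsilon> :: real
  assumes r_bound: "norm (r j) \<le> C * B ^ j"
    and nonneg: "0 \<le> C" "0 \<le> B" and \<epsilon>: "0 < \<epsilon>" "\<epsilon> \<le> 1"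
    and B\<epsilon>: "B * \<epsilon> \<le> 1/8" and C\<epsilon>: "8 * C * \<epsilon> \<le> 1"
begin

definition Rf :: "complex \<Rightarrow> complex" where "Rf u = (\<Sum>j. r j * u ^ j)"

lemma norm_term_le: "norm (r j) * \<epsilon> ^ j \<le> C * (1/8) ^ j"
proof -
  have "norm (r j) * \<epsilon> ^ j \<le> C * B ^ j * \<epsilon> ^ j"
    using r_bound \<epsilon> by (intro mult_right_mono) auto
  also have "\<dots> = C * (B * \<epsilon>) ^ j" by (simp add: power_mult_distrib)
  also have "\<dots> \<le> C * (1/8) ^ j"
    using nonneg \<epsilon> B\<epsilon> by (intro mult_left_mono power_mono) auto
  finally show ?thesis .
qed

lemma sum_term_le:
  assumes "\<And>j. norm (q j) \<le> \<epsilon> ^ j"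
  shows "summable (\<lambda>j. norm (r j * q j))" "norm (\<Sum>j. r j * q j) \<le> 2 * C"
proof -
  have le: "norm (r j * q j) \<le> C * (1/8) ^ j" for j
  proof -
    have "norm (r j * q j) \<le> norm (r j) * \<epsilon> ^ j"
      unfolding norm_mult using assms by (intro mult_left_mono) auto
    then show ?thesis using norm_term_le[of j] by linarith
  qed
  have summ: "summable (\<lambda>j. C * (1/8) ^ j :: real)" by (intro summable_mult summable_geometric) simp
  show 1: "summable (\<lambda>j. norm (r j * q j))"
    by (rule summable_comparison_test[OF _ summ]) (use le in auto)
  have "norm (\<Sum>j. r j * q j) \<le> (\<Sum>j. C * (1/8) ^ j)"
    by (rule order_trans[OF summable_norm[OF 1]]) (intro suminf_le le 1 summ)
  also have "\<dots> = C * (8/7)" by (subst suminf_mult) (auto simp: suminf_geometric)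
  finally show "norm (\<Sum>j. r j * q j) \<le> 2 * C" using nonneg by linarith
qed

text \<open>The powers \<open>u\<^sup>j\<close> are replaced by arbitrary numbers \<open>q\<^sub>j\<close>, \<open>s\<^sub>j\<close>, because this estimate serves twice: for
  the Lipschitz constant of the series, and for the products of ratios in \<open>ratio_estimate\<close>. The
  quadratic growth in \<open>j\<close> that the latter needs is absorbed by \<open>j (j + 1) \<le> 2 \<cdot> 2\<^sup>j\<close>.\<close>

lemma sum_diff_le:
  assumes "\<And>j. norm (q j) \<le> \<epsilon> ^ j" "\<And>j. norm (s j) \<le> \<epsilon> ^ j" "D \<ge> 0"
    and le: "\<And>j. \<epsilon> * norm (q j - s j) \<le> 2 * real j * (real j + 1) * \<epsilon> ^ j * D"
  shows "\<epsilon>\<^sup>2 * norm ((\<Sum>j. r j * q j) - (\<Sum>j. r j * s j)) \<le> 2/3 * D"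
proof -
  have sum1: "summable (\<lambda>j. r j * q j)" "summable (\<lambda>j. r j * s j)"
    using summable_norm_cancel[OF sum_term_le(1)[of q]] summable_norm_cancel[OF sum_term_le(1)[of s]]
      assms(1,2) by auto
  have j2: "real j * (real j + 1) \<le> 2 * 2 ^ j" for j
  proof (induction j)
    case (Suc j)
    have "real j + 1 \<le> 2 ^ j" by (induction j) auto
    with Suc show ?case by (simp add: algebra_simps)
  qed auto
  have le': "\<epsilon> * norm (r j * (q j - s j)) \<le> 4 * C * D * (1/4) ^ j" for j
  proof -
    have "\<epsilon> * norm (r j * (q j - s j)) = norm (r j) * (\<epsilon> * norm (q j - s j))"
      by (simp add: norm_mult)
    also have "\<dots> \<le> norm (r j) * (2 * real j * (real j + 1) * \<epsilon> ^ j * D)"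
      using le by (intro mult_left_mono) auto
    also have "\<dots> = 2 * (norm (r j) * \<epsilon> ^ j) * (real j * (real j + 1)) * D" by simp
    also have "\<dots> \<le> 2 * (C * (1/8) ^ j) * (2 * 2 ^ j) * D"
      by (intro mult_right_mono[OF mult_mono] mult_left_mono[OF norm_term_le])
         (use norm_term_le[of j] j2[of j] nonneg assms(3) in auto)
    also have "\<dots> = 4 * C * D * ((1/8) ^ j * 2 ^ j)" by simp
    also have "(1/8) ^ j * 2 ^ j = (1/4 :: real) ^ j" by (simp flip: power_mult_distrib)
    finally show ?thesis .
  qed
  have summ: "summable (\<lambda>j. 4 * C * D * (1/4) ^ j / \<epsilon> :: real)"
    by (intro summable_divide summable_mult summable_geometric) simp
  have le'': "norm (r j * (q j - s j)) \<le> 4 * C * D * (1/4) ^ j / \<epsilon>" for j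
    using le'[of j] \<epsilon> by (simp add: field_simps)
  have summ': "summable (\<lambda>j. norm (r j * (q j - s j)))"
    by (rule summable_comparison_test[OF _ summ]) (use le'' in auto)
  have "norm ((\<Sum>j. r j * q j) - (\<Sum>j. r j * s j)) = norm (\<Sum>j. r j * (q j - s j))"
    using sum1 by (simp add: suminf_diff right_diff_distrib)
  also have "\<dots> \<le> (\<Sum>j. 4 * C * D * (1/4) ^ j / \<epsilon>)"
    by (rule order_trans[OF summable_norm[OF summ']]) (intro suminf_le le'' summ' summ)
  also have "\<dots> = 4 * C * D * (4/3) / \<epsilon>"
    by (subst suminf_divide, intro summable_mult summable_geometric, simp,
        subst suminf_mult, auto simp: suminf_geometric)
  finally have "\<epsilon>\<^sup>2 * norm ((\<Sum>j. r j * q j) - (\<Sum>j. r j * s j)) \<le> \<epsilon>\<^sup>2 * (4 * C * D * (4/3) / \<epsilon>)"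
    by (intro mult_left_mono) auto
  also have "\<dots> = (8 * C * \<epsilon>) * (2/3 * D)" using \<epsilon> by (simp add: power2_eq_square)
  also have "\<dots> \<le> 1 * (2/3 * D)" using C\<epsilon> assms(3) by (intro mult_right_mono) auto
  finally show ?thesis by simp
qed

lemma Rf_bound: "norm u \<le> \<epsilon> \<Longrightarrow> norm (Rf u) \<le> 2 * C"
  unfolding Rf_def by (rule sum_term_le) (auto simp: norm_power intro: power_mono)

lemma Rf_lipschitz:
  assumes u: "norm u \<le> \<epsilon>" and v: "norm v \<le> \<epsilon>"
  shows "\<epsilon>\<^sup>2 * norm (Rf u - Rf v) \<le> 2/3 * norm (u - v)"
  unfolding Rf_def
proof (rule sum_diff_le)
  show "\<epsilon> * norm (u ^ j - v ^ j) \<le> 2 * real j * (real j + 1) * \<epsilon> ^ j * norm (u - v)" for j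
  proof -
    have "\<epsilon> * norm (u ^ j - v ^ j) \<le> \<epsilon> ^ j * (real j * norm (u - v))"
      using norm_prod_minus_power_le[of j "\<lambda>_. u" \<epsilon> v] u v by simp
    also have "\<dots> \<le> \<epsilon> ^ j * (2 * real j * (real j + 1) * norm (u - v))"
    proof -
      have "real j \<le> 2 * real j * (real j + 1)" by (simp add: algebra_simps)
      then show ?thesis using \<epsilon> by (intro mult_left_mono mult_right_mono) auto
    qed
    finally show ?thesis by (simp add: algebra_simps)
  qed
qed (use u v in \<open>auto simp: norm_power intro: power_mono\<close>)

lemma Rf_holomorphic: "Rf holomorphic_on ball 0 \<epsilon>"
proof -
  have "(\<lambda>u. r j * u ^ j) holomorphic_on ball 0 \<epsilon>" for j by (intro holomorphic_intros)
  have "uniform_limit (ball 0 \<epsilon>) (\<lambda>n u. \<Sum>j<n. r j * u ^ j) Rf sequentially"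
    unfolding Rf_def
  proof (rule Weierstrass_m_test)
    show "summable (\<lambda>j. C * (1/8) ^ j :: real)" by (intro summable_mult summable_geometric) simp
    fix j u assume "u \<in> ball (0::complex) \<epsilon>"
    then have "norm (r j * u ^ j) \<le> norm (r j) * \<epsilon> ^ j"
      unfolding norm_mult norm_power by (intro mult_left_mono power_mono) auto
    then show "norm (r j * u ^ j) \<le> C * (1/8) ^ j" using norm_term_le[of j] by linarith
  qed
  note lim = this
  show ?thesis
  proof (rule holomorphic_uniform_sequence)
    show "(\<lambda>u. \<Sum>j<n. r j * u ^ j) holomorphic_on ball 0 \<epsilon>" for n
      by (intro holomorphic_intros)
    fix x assume x: "x \<in> ball (0::complex) \<epsilon>"
    then obtain e where e: "e > 0" "cball x e \<subseteq> ball 0 \<epsilon>"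
      by (meson open_ball open_contains_cball)
    then have "uniform_limit (cball x e) (\<lambda>n u. \<Sum>j<n. r j * u ^ j) Rf sequentially"
      using uniform_limit_on_subset[OF lim] by blast
    with e show "\<exists>d>0. cball x d \<subseteq> ball 0 \<epsilon> \<and>
        uniform_limit (cball x d) (\<lambda>n u. \<Sum>j<n. r j * u ^ j) Rf sequentially"
      by blast
  qed auto
qed

lemma denominator_ge:
  fixes z w :: complex
  assumes "norm z \<ge> 2 / \<epsilon>" "0 \<le> \<theta>" "\<theta> \<le> 1" "norm w \<le> 2 * C"
  shows "norm (z - of_real \<theta> * w) \<ge> 1 / \<epsilon>"
proof -
  have "norm (of_real \<theta> * w) \<le> 1 * (2 * C)"
    unfolding norm_mult using assms by (intro mult_mono) auto
  moreover have "2 * C \<le> 1 / \<epsilon>" using C\<epsilon> \<epsilon> nonneg by (simp add: field_simps)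
  ultimately show ?thesis
    using assms(1) norm_triangle_ineq2[of z "of_real \<theta> * w"] by (simp add: field_simps)
qed

lemma norm_inverse_le:
  assumes "norm (D :: complex) \<ge> 1 / \<epsilon>" shows "D \<noteq> 0" "norm (1 / D) \<le> \<epsilon>"
proof -
  show "D \<noteq> 0" using assms \<epsilon> by auto
  then show "norm (1 / D) \<le> \<epsilon>" using assms \<epsilon> by (simp add: norm_divide field_simps)
qed

lemma norm_inverse_diff_le:
  assumes "norm (D :: complex) \<ge> 1 / \<epsilon>" "norm E \<ge> 1 / \<epsilon>"
  shows "norm (1 / D - 1 / E) \<le> \<epsilon>\<^sup>2 * norm (D - E)"
proof -
  have "1 / D - 1 / E = (1 / D) * (1 / E) * (E - D)"
    using norm_inverse_le(1)[OF assms(1)] norm_inverse_le(1)[OF assms(2)] by (simp add: field_simps)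
  then have "norm (1 / D - 1 / E) = norm (1 / D) * norm (1 / E) * norm (D - E)"
    by (simp only: norm_mult norm_minus_commute)
  also have "\<dots> \<le> \<epsilon> * \<epsilon> * norm (D - E)"
    using norm_inverse_le(2)[OF assms(1)] norm_inverse_le(2)[OF assms(2)] \<epsilon>
    by (intro mult_right_mono mult_mono) auto
  finally show ?thesis by (simp add: power2_eq_square)
qed

lemma fixpoint_exists:
  assumes z: "norm z \<ge> 2 / \<epsilon>" and \<theta>: "0 \<le> \<theta>" "\<theta> \<le> 1"
  obtains U where "norm U \<le> \<epsilon>" "U = 1 / (z - of_real \<theta> * Rf U)"
proof -
  define \<phi> where "\<phi> u = 1 / (z - of_real \<theta> * Rf u)" for u
  have "\<exists>!u\<in>cball 0 \<epsilon>. \<phi> u = u"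
  proof (rule Banach_fix[OF complete_eq_closed[THEN iffD2, OF closed_cball], of _ _ "2/3"])
    show "cball (0::complex) \<epsilon> \<noteq> {}" using \<epsilon> by auto
    show "\<phi> ` cball 0 \<epsilon> \<subseteq> cball 0 \<epsilon>"
      unfolding \<phi>_def
      by (auto intro!: norm_inverse_le denominator_ge[OF z \<theta>] Rf_bound simp del: norm_divide
          simp: norm_divide[symmetric])
    fix u v assume uv: "u \<in> cball (0::complex) \<epsilon>" "v \<in> cball (0::complex) \<epsilon>"
    have "norm (\<phi> u - \<phi> v) \<le> \<epsilon>\<^sup>2 * norm ((z - of_real \<theta> * Rf u) - (z - of_real \<theta> * Rf v))"
      unfolding \<phi>_def
      by (intro norm_inverse_diff_le denominator_ge[OF z \<theta>] Rf_bound) (use uv in auto)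
    also have "(z - of_real \<theta> * Rf u) - (z - of_real \<theta> * Rf v) = of_real \<theta> * (Rf v - Rf u)"
      by (simp add: algebra_simps)
    also have "\<epsilon>\<^sup>2 * norm (of_real \<theta> * (Rf v - Rf u)) \<le> \<epsilon>\<^sup>2 * (1 * norm (Rf v - Rf u))"
      unfolding norm_mult using \<theta> by (intro mult_left_mono mult_right_mono) auto
    also have "\<dots> \<le> 2/3 * norm (v - u)" using Rf_lipschitz[of v u] uv by auto
    finally show "dist (\<phi> u) (\<phi> v) \<le> 2/3 * dist u v"
      by (simp add: dist_norm norm_minus_commute)
  qed auto
  then obtain u where u: "u \<in> cball 0 \<epsilon>" "\<phi> u = u" by blast
  show ?thesis
    by (rule that[of u]) (use u(1) u(2)[symmetric] in \<open>simp_all only: \<phi>_def mem_cball dist_0_norm\<close>)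
qed

lemma fixpoint_unique:
  assumes "norm u \<le> \<epsilon>" "norm v \<le> \<epsilon>" "u \<noteq> 0" "v \<noteq> 0" "0 \<le> \<theta>" "\<theta> \<le> 1"
    and eq: "1 / u + of_real \<theta> * Rf u = 1 / v + of_real \<theta> * Rf v"
  shows "u = v"
proof -
  have "u - v = u * v * (of_real \<theta> * (Rf u - Rf v))"
    using eq assms(3,4) by (simp add: field_simps)
  then have "norm (u - v) = norm u * norm v * (\<theta> * norm (Rf u - Rf v))"
    by (simp only: norm_mult norm_of_real abs_of_nonneg[OF assms(5)] mult.assoc)
  also have "\<dots> \<le> (\<epsilon> * \<epsilon>) * (1 * norm (Rf u - Rf v))"
    using assms \<epsilon> by (intro mult_mono) auto
  also have "\<dots> \<le> 2/3 * norm (u - v)"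
    using Rf_lipschitz[OF assms(1,2)] by (simp add: power2_eq_square)
  finally show ?thesis by simp
qed

text \<open>The ratios \<open>a\<^sub>k / a\<^bsub>k+1\<^esub>\<close> approach the fixed point \<open>U\<close> at the explicit rate \<open>(n - k) / n\<close>. This
  quantity is compatible with the induction: if the ratios of index below \<open>k\<close> satisfy the estimate, then
  in the recurrence for \<open>a\<^bsub>k+1\<^esub>\<close> the product that takes the place of \<open>U\<^sup>j\<close> differs from it by at most
  a constant times \<open>j (j + 1) \<epsilon>\<^bsup>j-1\<^esup> (n - k) / n\<close>, and the contraction more than compensates the constant.\<close>

lemma ratio_estimate:
  fixes a :: "nat \<Rightarrow> complex"
  assumes z: "norm z \<ge> 2 / \<epsilon>" and \<theta>: "0 \<le> \<theta>" "\<theta> \<le> 1"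
    and U: "norm U \<le> \<epsilon>" "U = 1 / (z - of_real \<theta> * Rf U)"
    and a0: "a 0 = 1"
    and rec: "\<And>k. k < n \<Longrightarrow> a (Suc k) = z * a k -
      of_real \<theta> * (\<Sum>j\<le>k. r j / of_nat n ^ j * (fact k / fact (k - j)) * a (k - j))"
  shows "k < n \<Longrightarrow> a (Suc k) \<noteq> 0 \<and> norm (a k / a (Suc k)) \<le> \<epsilon> \<and>
    norm (a k / a (Suc k) - U) \<le> (real n - real k) / real n"
proof (induction k rule: less_induct)
  case (less k)
  have ak: "a i \<noteq> 0" if "i \<le> k" for i
    using less that a0 by (cases i) auto
  \<comment> \<open>The weight \<open>k (k-1) \<dots> (k-j+1) / n\<^sup>j\<close> is spread over the ratios, so that weight and ratios together form a
    single product, equal to \<open>0\<close> once \<open>j\<close> exceeds \<open>k\<close>.\<close>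
  define v where "v l = of_real ((real k - real l) / real n) * (a (k - Suc l) / a (k - l))" for l
  define q where "q j = (if j \<le> k then (\<Prod>l<j. v l) else 0)" for j
  define \<delta> where "\<delta> = (real n - real k) / real n"
  have \<delta>: "\<delta> > 0" using less.prems by (simp add: \<delta>_def)
  have n0: "real n > 0" using less.prems by simp
  have IH: "norm (a (k - Suc l) / a (k - l)) \<le> \<epsilon>"
      "norm (a (k - Suc l) / a (k - l) - U) \<le> (real n - real k + real l + 1) / real n" if "l < k" for l
  proof -
    have "k - l = Suc (k - Suc l)" "k - Suc l < k" using that by auto
    with less.IH[of "k - Suc l"] less.prems that
    show "norm (a (k - Suc l) / a (k - l)) \<le> \<epsilon>"
      "norm (a (k - Suc l) / a (k - l) - U) \<le> (real n - real k + real l + 1) / real n"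
      by (auto simp: of_nat_diff algebra_simps)
  qed
  have v1: "norm (v l) \<le> \<epsilon>" if "l < k" for l
  proof -
    have "norm (v l) = (real k - real l) / real n * norm (a (k - Suc l) / a (k - l))"
      using that n0 unfolding v_def norm_mult norm_of_real by simp
    also have "\<dots> \<le> 1 * \<epsilon>"
      using that less.prems IH(1)[OF that] n0 by (intro mult_mono) (auto simp: field_simps)
    finally show ?thesis by simp
  qed
  have v2: "norm (v l - U) \<le> 2 * (real l + 2) * \<delta>" if "l < k" for l
  proof -
    define x where "x = a (k - Suc l) / a (k - l)"
    define t where "t = (real k - real l) / real n"
    have t: "t \<le> 1" "0 \<le> t" using that less.prems n0 by (auto simp: t_def field_simps)
    have "v l - U = (x - U) - of_real (1 - t) * x"
      by (simp add: v_def x_def[symmetric] t_def[symmetric] algebra_simps)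
    then have "norm (v l - U) \<le> norm (x - U) + (1 - t) * norm x"
    proof -
      have "norm (complex_of_real (1 - t) * x) = (1 - t) * norm x"
        unfolding norm_mult norm_of_real using t by simp
      then show ?thesis
        using norm_triangle_ineq4[of "x - U" "of_real (1 - t) * x"] \<open>v l - U = _\<close> by (simp only:)
    qed
    also have "\<dots> \<le> (real n - real k + real l + 1) / real n + (1 - t) * 1"
      using IH[OF that] \<epsilon> t unfolding x_def[symmetric] by (intro add_mono mult_left_mono) auto
    also have "\<dots> = (2 * (real n - real k) + 2 * real l + 1) / real n"
      using n0 by (simp add: t_def field_simps)
    also have "\<dots> \<le> (2 * (real l + 2) * (real n - real k)) / real n"
    proof (rule divide_right_mono)
      have "real n - real k \<ge> 1" using less.prems by linarith
      then have "(2 * real l + 2) * (real n - real k) \<ge> (2 * real l + 2) * 1"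
        by (intro mult_left_mono) auto
      then show "2 * (real n - real k) + 2 * real l + 1 \<le> 2 * (real l + 2) * (real n - real k)"
        by (simp add: algebra_simps)
    qed (use n0 in auto)
    finally show ?thesis by (simp add: \<delta>_def)
  qed
  have q1: "norm (q j) \<le> \<epsilon> ^ j" for j
  proof (cases "j \<le> k")
    case True
    then have "norm (\<Prod>l<j. v l) \<le> (\<Prod>l<j. \<epsilon>)"
      using v1 unfolding prod_norm[symmetric] by (intro prod_mono) auto
    then show ?thesis using True by (simp add: q_def)
  qed (use \<epsilon> in \<open>auto simp: q_def\<close>)
  have q2: "\<epsilon> * norm (q j - U ^ j) \<le> 2 * real j * (real j + 1) * \<epsilon> ^ j * \<delta>" for j
  proof (cases "j \<le> k")
    case True
    have "\<epsilon> * norm (q j - U ^ j) \<le> \<epsilon> ^ j * (\<Sum>l<j. norm (v l - U))"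
      using norm_prod_minus_power_le[of j v \<epsilon> U] v1 U True by (simp add: q_def)
    also have "\<dots> \<le> \<epsilon> ^ j * (\<Sum>l<j. 2 * (real j + 1) * \<delta>)"
    proof (intro mult_left_mono sum_mono)
      fix l assume l: "l \<in> {..<j}"
      have "norm (v l - U) \<le> 2 * (real l + 2) * \<delta>" using v2 l True by auto
      also have "\<dots> \<le> 2 * (real j + 1) * \<delta>" using l \<delta> by (intro mult_right_mono) auto
      finally show "norm (v l - U) \<le> 2 * (real j + 1) * \<delta>" .
    qed (use \<epsilon> in auto)
    finally show ?thesis by (simp add: algebra_simps)
  next
    case False
    \<comment> \<open>Here only \<open>U\<^sup>j\<close> remains. It is small enough because \<open>j \<ge> k + 1\<close> and \<open>(k + 1) (n - k) \<ge> n\<close>.\<close>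
    have "1 \<le> real j * \<delta>"
    proof -
      have "real n \<le> (real k + 1) * (real n - real k)"
      proof -
        have "real k * 1 \<le> real k * (real n - real k)"
          using less.prems by (intro mult_left_mono) auto
        then show ?thesis by (simp add: algebra_simps)
      qed
      also have "\<dots> \<le> real j * (real n - real k)"
        using False less.prems by (intro mult_right_mono) auto
      finally show ?thesis using n0 by (simp add: \<delta>_def field_simps)
    qed
    moreover have "real j * \<delta> \<le> (2 * (real j + 1)) * (real j * \<delta>)"
      using \<delta> mult_right_mono[of 1 "2 * (real j + 1)" "real j * \<delta>"] by simp
    ultimately have one: "1 \<le> 2 * real j * (real j + 1) * \<delta>" by (simp add: algebra_simps)
    have "\<epsilon> * norm (q j - U ^ j) \<le> 1 * \<epsilon> ^ j"
      using False \<epsilon> U by (intro mult_mono) (auto simp: q_def norm_power intro: power_mono)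
    also have "\<dots> \<le> (2 * real j * (real j + 1) * \<delta>) * \<epsilon> ^ j"
      using one \<epsilon> by (intro mult_right_mono) auto
    finally show ?thesis by (simp add: algebra_simps)
  qed
  define D where "D = z - of_real \<theta> * (\<Sum>j. r j * q j)"
  define E where "E = z - of_real \<theta> * Rf U"
  have prod_v: "(\<Prod>l<j. v l) = fact k / fact (k - j) / of_nat n ^ j * (a (k - j) / a k)" if "j \<le> k" for j
    using that
  proof (induction j)
    case 0 then show ?case using ak by simp
  next
    case (Suc j)
    have f: "fact (k - j) = of_nat (k - j) * (fact (k - Suc j) :: complex)"
    proof -
      have kj: "k - j = Suc (k - Suc j)" using Suc.prems by simp
      show ?thesis unfolding kj by (rule fact_Suc)
    qed
    have nz: "of_nat (k - j) \<noteq> (0 :: complex)" "a (k - j) \<noteq> 0" "a k \<noteq> 0"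
      using Suc.prems ak by (simp_all del: of_nat_diff)
    have vj: "v j = of_nat (k - j) / of_nat n * (a (k - Suc j) / a (k - j))"
      using Suc.prems by (simp add: v_def of_nat_diff)
    have "(\<Prod>l<Suc j. v l) = fact k / fact (k - j) / of_nat n ^ j * (a (k - j) / a k) * v j"
      using Suc by simp
    then show ?case
      unfolding f vj using nz by (simp add: field_simps del: of_nat_diff)
  qed
  have "(\<Sum>j. r j * q j) = (\<Sum>j\<le>k. r j * q j)"
    by (rule suminf_finite) (auto simp: q_def)
  also have "\<dots> * a k = (\<Sum>j\<le>k. r j / of_nat n ^ j * (fact k / fact (k - j)) * a (k - j))"
    unfolding sum_distrib_right using ak[of k]
    by (intro sum.cong) (auto simp: q_def prod_v mult_ac)
  finally have "D * a k = a (Suc k)"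
    unfolding rec[OF less.prems] D_def by (simp add: algebra_simps)
  moreover have Dge: "norm D \<ge> 1 / \<epsilon>"
    unfolding D_def by (intro denominator_ge z \<theta> sum_term_le q1)
  ultimately have u: "a (Suc k) \<noteq> 0" "a k / a (Suc k) = 1 / D"
    using norm_inverse_le(1)[OF Dge] ak[of k] by (auto simp: field_simps)
  have Ege: "norm E \<ge> 1 / \<epsilon>"
    unfolding E_def by (intro denominator_ge z \<theta> Rf_bound U)
  have "norm (1 / D - U) \<le> \<epsilon>\<^sup>2 * norm (D - E)"
    using norm_inverse_diff_le[OF Dge Ege] U(2) by (simp add: E_def)
  also have "D - E = of_real \<theta> * (Rf U - (\<Sum>j. r j * q j))"
    by (simp add: D_def E_def algebra_simps)
  also have "\<epsilon>\<^sup>2 * norm \<dots> \<le> \<epsilon>\<^sup>2 * (1 * norm (Rf U - (\<Sum>j. r j * q j)))"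
    unfolding norm_mult using \<theta> by (intro mult_left_mono mult_right_mono) auto
  also have "\<dots> = \<epsilon>\<^sup>2 * norm ((\<Sum>j. r j * q j) - (\<Sum>j. r j * U ^ j))"
    by (simp add: Rf_def norm_minus_commute)
  also have "\<dots> \<le> 2/3 * \<delta>"
    by (intro sum_diff_le q1 q2) (use U \<delta> in \<open>auto simp: norm_power intro: power_mono\<close>)
  also have "\<dots> \<le> \<delta>" using \<delta> by simp
  finally show ?case
    using u norm_inverse_le(2)[OF Dge] by (simp add: \<delta>_def)
qed

end

section \<open>Cauchy transforms determine measures\<close>

lemma norm_diff_of_real_ge: "norm (z - complex_of_real t) \<ge> \<bar>Im z\<bar>"
  using abs_Im_le_cmod[of "z - of_real t"] by simp

lemma norm_resolvent_le:
  assumes "Im z \<noteq> 0" shows "norm (1 / (z - complex_of_real t)) \<le> 1 / \<bar>Im z\<bar>"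
proof -
  have "\<bar>Im z\<bar> \<le> norm (z - of_real t)" "0 < \<bar>Im z\<bar>"
    using assms norm_diff_of_real_ge by auto
  then show ?thesis
    unfolding norm_divide norm_one by (intro divide_left_mono mult_pos_pos) linarith+
qed

lemma resolvent_nz: "Im z \<noteq> 0 \<Longrightarrow> z - complex_of_real t \<noteq> 0"
  by (auto simp: complex_eq_iff)

lemma (in real_distribution) integrable_resolvent:
  assumes "Im z \<noteq> 0" shows "integrable M (\<lambda>t. 1 / (z - complex_of_real t))"
  by (rule integrable_const_bound[where B = "1 / \<bar>Im z\<bar>"])
     (use norm_resolvent_le[OF assms] in auto)

text \<open>Differentiation under the integral sign: the error of the difference quotient is the integral of
  \<open>h / ((z + h - t) (z - t)\<^sup>2)\<close>, of order \<open>h\<close> uniformly in \<open>t\<close>.\<close>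

lemma (in real_distribution) Cauchy_transform_holomorphic:
  "Cauchy_transform M holomorphic_on {z. Im z > 0}"
proof -
  have op: "open {z. Im z > 0}" by (rule open_halfspace_Im_gt)
  have "\<exists>D. (Cauchy_transform M has_field_derivative D) (at z)" if z: "Im z > 0" for z
  proof
    define y where "y = Im z"
    have y: "y > 0" using z by (simp add: y_def)
    define D where "D = - (LINT t|M. 1 / (z - of_real t)\<^sup>2)"
    have int2: "integrable M (\<lambda>t. 1 / (z - complex_of_real t)\<^sup>2)"
    proof (rule integrable_const_bound[where B = "(1 / y)\<^sup>2"])
      show "AE t in M. norm (1 / (z - complex_of_real t)\<^sup>2) \<le> (1 / y)\<^sup>2"
        using norm_resolvent_le[of z] z power_mono[OF norm_resolvent_le[of z], where n=2]
        by (auto simp: y_def norm_divide norm_power power_divide)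
    qed auto
    have bound: "norm ((Cauchy_transform M (z + h) - Cauchy_transform M z) / h - D)
        \<le> 2 / y ^ 3 * norm h" if h: "h \<noteq> 0" "norm h < y / 2" for h
    proof -
      have Im: "Im (z + h) \<ge> y / 2"
        using h abs_Im_le_cmod[of h] by (auto simp: y_def)
      then have Im': "Im (z + h) \<noteq> 0" using y by auto
      have eq: "(1 / (z + h - of_real t) - 1 / (z - of_real t)) / h + 1 / (z - of_real t)\<^sup>2
          = h * (1 / (z + h - of_real t) * (1 / (z - of_real t))\<^sup>2)" for t
      proof -
        have "z + h - of_real t \<noteq> 0" "z - of_real t \<noteq> 0"
          using resolvent_nz[OF Im', of t] resolvent_nz[of z t] z by auto
        moreover define a b where "a = z + h - of_real t" and "b = z - of_real t"
        ultimately have ab: "a \<noteq> 0" "b \<noteq> 0" "h = a - b" by auto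
        have "(1 / a - 1 / b) / h + 1 / b\<^sup>2 = h * (1 / a * (1 / b)\<^sup>2)"
          using ab(1,2) h(1) unfolding ab(3) by (simp add: field_simps power2_eq_square)
        then show ?thesis by (simp add: a_def b_def)
      qed
      have "(Cauchy_transform M (z + h) - Cauchy_transform M z) / h - D
          = (LINT t|M. (1 / (z + h - of_real t) - 1 / (z - of_real t)) / h + 1 / (z - of_real t)\<^sup>2)"
        using integrable_resolvent[OF Im'] integrable_resolvent[of z] z int2
        by (simp add: Cauchy_transform_def D_def)
      also have "norm \<dots> \<le> (LINT t|M. 2 / y ^ 3 * norm h)"
      proof (rule Bochner_Integration.integral_norm_bound_integral)
        show "integrable M (\<lambda>t. (1 / (z + h - of_real t) - 1 / (z - of_real t)) / h + 1 / (z - of_real t)\<^sup>2)"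
          using integrable_resolvent[OF Im'] integrable_resolvent[of z] z int2 by auto
        fix t
        have "norm (1 / (z + h - of_real t)) \<le> 1 / (y / 2)"
        proof (rule order_trans[OF norm_resolvent_le[OF Im']])
          show "1 / \<bar>Im (z + h)\<bar> \<le> 1 / (y / 2)"
            using Im y by (intro divide_left_mono mult_pos_pos) linarith+
        qed
        moreover have "(norm (1 / (z - of_real t)))\<^sup>2 \<le> (1 / y)\<^sup>2"
          using norm_resolvent_le[of z t] z by (intro power_mono) (auto simp: y_def)
        ultimately have "norm h * (norm (1 / (z + h - of_real t)) * (norm (1 / (z - of_real t)))\<^sup>2)
            \<le> norm h * (1 / (y / 2) * (1 / y)\<^sup>2)"
          using y by (intro mult_left_mono mult_mono) auto
        also have "\<dots> = 2 / y ^ 3 * norm h" by (simp add: power2_eq_square power3_eq_cube mult_ac)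
        finally show "norm ((1 / (z + h - of_real t) - 1 / (z - of_real t)) / h + 1 / (z - of_real t)\<^sup>2)
            \<le> 2 / y ^ 3 * norm h"
          unfolding eq by (simp only: norm_mult norm_power)
      qed auto
      also have "\<dots> = 2 / y ^ 3 * norm h" using prob_space by simp
      finally show ?thesis .
    qed
    have "((\<lambda>h. (Cauchy_transform M (z + h) - Cauchy_transform M z) / h - D) \<longlongrightarrow> 0) (at 0)"
    proof (rule Lim_null_comparison)
      show "\<forall>\<^sub>F h in at 0. norm ((Cauchy_transform M (z + h) - Cauchy_transform M z) / h - D)
          \<le> 2 / y ^ 3 * norm h"
        unfolding eventually_at using bound y by (intro exI[of _ "y / 2"]) auto
      show "((\<lambda>h::complex. 2 / y ^ 3 * norm h) \<longlongrightarrow> 0) (at 0)"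
        by (rule tendsto_eq_intros refl)+ auto
    qed
    then show "(Cauchy_transform M has_field_derivative D) (at z)"
      unfolding DERIV_def by (simp add: LIM_zero_iff)
  qed
  then show ?thesis
    by (auto simp: holomorphic_on_open[OF op])
qed

definition Poisson_kernel :: "real \<Rightarrow> real \<Rightarrow> real" where
  "Poisson_kernel y x = y / (x\<^sup>2 + y\<^sup>2)"

lemma integrable_inverse_one_plus_square: "integrable lborel (\<lambda>x::real. inverse (1 + x\<^sup>2))"
  using integrable_inverse_1_plus_square by (simp add: set_integrable_def einterval_def)

lemma Poisson_kernel_altdef:
  assumes "y > 0" shows "Poisson_kernel y x = 1 / y * inverse (1 + (x / y)\<^sup>2)"
proof -
  have "x\<^sup>2 + y\<^sup>2 > 0" using assms by (simp add: add_nonneg_pos)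
  then show ?thesis using assms unfolding Poisson_kernel_def by (simp add: field_simps power2_eq_square)
qed

lemma integrable_Poisson_kernel:
  assumes "y > 0" shows "integrable lborel (\<lambda>x. Poisson_kernel y (x - t))"
proof -
  have "integrable lborel (\<lambda>x. inverse (1 + (- t / y + (1 / y) * x)\<^sup>2))"
    using integrable_inverse_one_plus_square by (rule lborel_integrable_real_affine) (use assms in auto)
  then have "integrable lborel (\<lambda>x. 1 / y * inverse (1 + (- t / y + (1 / y) * x)\<^sup>2))"
    by (rule integrable_mult_right)
  then show ?thesis
    using assms by (simp add: Poisson_kernel_altdef diff_divide_distrib)
qed

lemma Poisson_kernel_nonneg: "y > 0 \<Longrightarrow> Poisson_kernel y x \<ge> 0"
  by (simp add: Poisson_kernel_def)

lemma measurable_Poisson_kernel[measurable]: "Poisson_kernel y \<in> borel_measurable borel"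
  unfolding Poisson_kernel_def by measurable

definition Poisson_fourier :: "real \<Rightarrow> real \<Rightarrow> complex" where
  "Poisson_fourier y s = (LINT x|lborel. iexp (s * x) * of_real (Poisson_kernel y x))"

lemma norm_iexp_times: "norm (iexp a * of_real b) = \<bar>b\<bar>"
  unfolding norm_mult norm_exp_i_times by simp

lemma integrable_iexp_Poisson:
  "y > 0 \<Longrightarrow> integrable lborel (\<lambda>x. iexp (s * x) * of_real (Poisson_kernel y (x - t)))"
  by (rule Bochner_Integration.integrable_bound[OF integrable_Poisson_kernel[of y t]])
     (simp_all only: norm_iexp_times, auto)

lemma Poisson_fourier_shift:
  assumes "y > 0"
  shows "(LINT x|lborel. iexp (s * x) * of_real (Poisson_kernel y (x - t)))
    = iexp (s * t) * Poisson_fourier y s"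
proof -
  have "(LINT x|lborel. iexp (s * x) * of_real (Poisson_kernel y (x - t)))
      = (LINT x|lborel. iexp (s * (t + 1 * x)) * of_real (Poisson_kernel y ((t + 1 * x) - t)))"
    by (subst lborel_integral_real_affine[where c = 1 and t = t]) auto
  also have "\<dots> = (LINT x|lborel. iexp (s * t) * (iexp (s * x) * of_real (Poisson_kernel y x)))"
    by (intro Bochner_Integration.integral_cong) (auto simp: ring_distribs exp_add)
  also have "\<dots> = iexp (s * t) * Poisson_fourier y s"
    unfolding Poisson_fourier_def by (rule integral_mult_right_zero)
  finally show ?thesis .
qed

text \<open>After rescaling, the transform at \<open>s\<close> of the Poisson kernel of width \<open>y\<close> is the integral of
  \<open>exp (i s y u) / (1 + u\<^sup>2)\<close>, which tends to \<open>\<pi>\<close> as \<open>y\<close> tends to \<open>0\<close>. This soft argument avoids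
  computing it.\<close>

lemma Poisson_fourier_nonzero: "\<exists>y>0. Poisson_fourier y s \<noteq> 0"
proof -
  define w where "w n u = iexp (s * u / real (Suc n)) * complex_of_real (inverse (1 + u\<^sup>2))" for n :: nat and u
  have eq: "Poisson_fourier (1 / real (Suc n)) s = (LINT u|lborel. w n u)" for n
  proof -
    define y where "y = 1 / real (Suc n)"
    have y: "y > 0" by (simp add: y_def)
    have ny: "1 + of_nat n \<noteq> (0 :: complex)" by (metis of_nat_Suc of_nat_neq_0)
    have "Poisson_fourier y s
        = \<bar>y\<bar> *\<^sub>R (LINT u|lborel. iexp (s * (0 + y * u)) * of_real (Poisson_kernel y (0 + y * u)))"
      unfolding Poisson_fourier_def by (rule lborel_integral_real_affine) (use y in auto)
    also have "\<dots> = (LINT u|lborel. w n u)"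
      unfolding w_def using y
      by (subst integral_scaleR_right[symmetric], intro Bochner_Integration.integral_cong)
         (auto simp: Poisson_kernel_altdef scaleR_conv_of_real y_def ny)
    finally show ?thesis unfolding y_def .
  qed
  have "(\<lambda>n. LINT u|lborel. w n u) \<longlonglongrightarrow> (LINT u|lborel. complex_of_real (inverse (1 + u\<^sup>2)))"
  proof (rule integral_dominated_convergence[where w = "\<lambda>u. inverse (1 + u\<^sup>2)"])
    show "AE u in lborel. (\<lambda>n. w n u) \<longlonglongrightarrow> complex_of_real (inverse (1 + u\<^sup>2))"
    proof (rule AE_I2)
      fix u :: real
      have "(\<lambda>n. s * u * inverse (real (Suc n))) \<longlonglongrightarrow> s * u * 0"
        by (intro tendsto_intros LIMSEQ_inverse_real_of_nat)
      then have "(\<lambda>n. w n u) \<longlonglongrightarrow> iexp (s * u * 0) * complex_of_real (inverse (1 + u\<^sup>2))"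
        unfolding w_def divide_inverse by (intro tendsto_intros LIMSEQ_inverse_real_of_nat)
      then show "(\<lambda>n. w n u) \<longlonglongrightarrow> complex_of_real (inverse (1 + u\<^sup>2))" by simp
    qed
    show "AE u in lborel. norm (w n u) \<le> inverse (1 + u\<^sup>2)" for n
      by (rule AE_I2) (auto simp: w_def norm_mult simp del: of_real_inverse)
  qed (auto simp: w_def intro: integrable_inverse_one_plus_square)
  also have "(LINT u|lborel. complex_of_real (inverse (1 + u\<^sup>2))) = of_real pi"
    using LBINT_inverse_1_plus_square
    by (subst integral_complex_of_real) (simp add: interval_lebesgue_integral_def set_lebesgue_integral_def einterval_def)
  finally have "(\<lambda>n. Poisson_fourier (1 / real (Suc n)) s) \<longlonglongrightarrow> of_real pi" by (simp only: eq)
  moreover have "of_real pi \<noteq> (0::complex)" by simp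
  ultimately have "eventually (\<lambda>n. Poisson_fourier (1 / real (Suc n)) s \<noteq> 0) sequentially"
    by (rule tendsto_imp_eventually_ne)
  then obtain n where "Poisson_fourier (1 / real (Suc n)) s \<noteq> 0"
    unfolding eventually_sequentially by blast
  then show ?thesis by (intro exI[of _ "1 / real (Suc n)"]) simp
qed

context real_distribution begin

lemma Im_Cauchy_transform:
  assumes "y > 0"
  shows "- Im (Cauchy_transform M (Complex x y)) = (LINT t|M. Poisson_kernel y (x - t))"
proof -
  have "Im (Cauchy_transform M (Complex x y)) = (LINT t|M. Im (1 / (Complex x y - of_real t)))"
    unfolding Cauchy_transform_def
    by (rule integral_Im[symmetric]) (use integrable_resolvent[of "Complex x y"] assms in auto)
  also have "\<dots> = (LINT t|M. - Poisson_kernel y (x - t))"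
    by (intro Bochner_Integration.integral_cong) (auto simp: Poisson_kernel_def Im_divide)
  finally show ?thesis by simp
qed

text \<open>On the line of height \<open>y\<close> the imaginary part of the Cauchy transform is the convolution of the measure
  with the Poisson kernel, so its Fourier transform is a product.\<close>

lemma fourier_Im_Cauchy_transform:
  assumes y: "y > 0"
  shows "(LINT x|lborel. iexp (s * x) * of_real (- Im (Cauchy_transform M (Complex x y))))
    = char M s * Poisson_fourier y s"
proof -
  interpret L: sigma_finite_measure lborel by (rule lborel.sigma_finite_measure_axioms)
  interpret P: pair_sigma_finite M "lborel :: real measure" ..
  define f where "f t x = iexp (s * x) * complex_of_real (Poisson_kernel y (x - t))" for t x :: real
  have M[measurable_cong]: "sets M = sets borel" by simp
  have int: "integrable (M \<Otimes>\<^sub>M lborel) (case_prod f)"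
  proof (rule P.Fubini_integrable)
    show "case_prod f \<in> borel_measurable (M \<Otimes>\<^sub>M lborel)"
      unfolding f_def by measurable
    have "(LINT x|lborel. norm (f t x)) = (LINT x|lborel. Poisson_kernel y x)" for t
    proof -
      have "(LINT x|lborel. norm (f t x)) = (LINT x|lborel. Poisson_kernel y (x - t))"
        unfolding f_def norm_iexp_times using Poisson_kernel_nonneg[OF y] by simp
      also have "\<dots> = (LINT x|lborel. Poisson_kernel y x)"
        by (subst lborel_integral_real_affine[where c = 1 and t = t]) auto
      finally show ?thesis .
    qed
    then show "integrable M (\<lambda>t. LINT x|lborel. norm (case_prod f (t, x)))" by simp
    show "AE t in M. integrable lborel (\<lambda>x. case_prod f (t, x))"
      using integrable_iexp_Poisson[OF y] by (auto simp: f_def)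
  qed
  have "(LINT x|lborel. iexp (s * x) * of_real (- Im (Cauchy_transform M (Complex x y))))
      = (LINT x|lborel. (LINT t|M. f t x))"
    unfolding Im_Cauchy_transform[OF y] f_def by simp
  also have "\<dots> = (LINT t|M. (LINT x|lborel. f t x))"
    by (rule P.Fubini_integral[OF int])
  also have "\<dots> = (LINT t|M. iexp (s * t) * Poisson_fourier y s)"
    unfolding f_def Poisson_fourier_shift[OF y] ..
  also have "\<dots> = char M s * Poisson_fourier y s"
    unfolding char_def by (rule integral_mult_left_zero)
  finally show ?thesis .
qed

end

text \<open>The characteristic functions agree at \<open>s\<close>: divide by the Fourier transform of a Poisson kernel that
  does not vanish there.\<close>

lemma Cauchy_transform_unique:
  assumes "real_distribution M" "real_distribution N"
    and eq: "\<And>z. Im z > 0 \<Longrightarrow> Cauchy_transform M z = Cauchy_transform N z"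
  shows "M = N"
proof (rule Levy_uniqueness[OF assms(1,2)], rule ext)
  fix s
  obtain y where y: "y > 0" "Poisson_fourier y s \<noteq> 0" using Poisson_fourier_nonzero by blast
  have "char M s * Poisson_fourier y s = char N s * Poisson_fourier y s"
    using y(1) by (simp add: real_distribution.fourier_Im_Cauchy_transform[OF assms(1), symmetric]
        real_distribution.fourier_Im_Cauchy_transform[OF assms(2), symmetric] eq)
  with y show "char M s = char N s" by simp
qed

lemma Cauchy_transform_unique_open:
  assumes M: "real_distribution M" and N: "real_distribution N"
    and U: "open U" "U \<noteq> {}" "U \<subseteq> {z. Im z > 0}"
    and eq: "\<And>z. z \<in> U \<Longrightarrow> Cauchy_transform M z = Cauchy_transform N z"
  shows "M = N"
proof (rule Cauchy_transform_unique[OF M N])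
  fix z assume z: "Im z > 0"
  show "Cauchy_transform M z = Cauchy_transform N z"
    by (rule analytic_continuation_open[OF U(1) open_halfspace_Im_gt[of 0] U(2) _ U(3)
          real_distribution.Cauchy_transform_holomorphic[OF M]
          real_distribution.Cauchy_transform_holomorphic[OF N]])
       (use z eq in \<open>auto intro: convex_connected convex_halfspace_Im_gt\<close>)
qed

section \<open>Empirical root measures\<close>

lemma finite_real_roots: "p \<noteq> 0 \<Longrightarrow> finite {y. poly p (complex_of_real y) = 0}"
proof -
  assume "p \<noteq> 0"
  then have "finite (complex_of_real -` {z. poly p z = 0})"
    by (intro finite_vimageI poly_roots_finite) (auto simp: inj_on_def)
  then show ?thesis by (simp add: vimage_def)
qed

text \<open>The root measure is indexed by real numbers, the factorisation of \<open>p\<close> by complex ones.\<close>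

lemma sum_roots_real_rooted:
  fixes g :: "complex \<Rightarrow> 'a :: comm_monoid_add"
  assumes "real_rooted p"
  shows "(\<Sum>z | poly p z = 0. g z) = (\<Sum>y | poly p (complex_of_real y) = 0. g (of_real y))"
proof (rule sum.reindex_cong[of of_real])
  show "{z. poly p z = 0} = complex_of_real ` {y. poly p (complex_of_real y) = 0}"
  proof safe
    fix z assume z: "poly p z = 0"
    then have "Im z = 0" using assms by (auto simp: real_rooted_def)
    then have "complex_of_real (Re z) = z" by (simp add: complex_eq_iff)
    then show "z \<in> complex_of_real ` {y. poly p (complex_of_real y) = 0}"
      using z by (intro image_eqI[where x = "Re z"]) simp_all
  qed
qed (auto simp: inj_on_def)

lemma integral_empirical_root_measure:
  fixes g :: "real \<Rightarrow> complex"
  assumes "p \<noteq> 0" "g \<in> borel_measurable borel"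
  shows "(LINT t|empirical_root_measure p. g t)
    = (\<Sum>y | poly p (complex_of_real y) = 0. of_nat (order (of_real y) p) / of_nat (degree p) * g y)"
  unfolding empirical_root_measure_def
  by (subst integral_distr, simp add: measurable_def space_point_measure sets_point_measure)
     (auto simp: assms finite_real_roots lebesgue_integral_point_measure_finite scaleR_conv_of_real)

lemma emeasure_empirical_root_measure:
  assumes "p \<noteq> 0" "A \<in> sets borel"
  shows "emeasure (empirical_root_measure p) A
    = ennreal (\<Sum>y | y \<in> A \<and> poly p (complex_of_real y) = 0. real (order (of_real y) p) / real (degree p))"
proof -
  let ?Y = "{y. poly p (complex_of_real y) = 0}"
  have "emeasure (empirical_root_measure p) A
      = emeasure (point_measure ?Y (\<lambda>y. ennreal (real (order (of_real y) p) / real (degree p)))) (A \<inter> ?Y)"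
    unfolding empirical_root_measure_def
    by (subst emeasure_distr) (auto simp: assms measurable_def space_point_measure sets_point_measure)
  also have "\<dots> = (\<Sum>y\<in>A \<inter> ?Y. ennreal (real (order (of_real y) p) / real (degree p)))"
    using finite_real_roots[OF assms(1)] by (subst emeasure_point_measure_finite) auto
  also have "\<dots> = ennreal (\<Sum>y\<in>A \<inter> ?Y. real (order (of_real y) p) / real (degree p))"
    by (rule sum_ennreal) auto
  also have "A \<inter> ?Y = {y. y \<in> A \<and> poly p (complex_of_real y) = 0}" by auto
  finally show ?thesis .
qed

lemma sum_order_real_rooted:
  assumes "real_rooted p"
  shows "(\<Sum>y | poly p (complex_of_real y) = 0. order (of_real y) p) = degree p"
proof -
  have "p \<noteq> 0" using assms by (simp add: real_rooted_def)
  then have "degree p = (\<Sum>z | poly p z = 0. order z p)"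
    by (subst size_proots_complex[symmetric]) (simp add: size_multiset_overloaded_eq)
  then show ?thesis by (simp add: sum_roots_real_rooted[OF assms])
qed

lemma emeasure_empirical_root_measure_eq_1:
  assumes "real_rooted p" "degree p > 0" "A \<in> sets borel"
    and "\<And>y. poly p (complex_of_real y) = 0 \<Longrightarrow> y \<in> A"
  shows "emeasure (empirical_root_measure p) A = 1"
proof -
  have "p \<noteq> 0" using assms by (simp add: real_rooted_def)
  then have "emeasure (empirical_root_measure p) A
      = ennreal (\<Sum>y | poly p (complex_of_real y) = 0. real (order (of_real y) p) / real (degree p))"
    by (subst emeasure_empirical_root_measure) (use assms in \<open>auto intro!: arg_cong[where f = ennreal] sum.cong\<close>)
  also have "(\<Sum>y | poly p (complex_of_real y) = 0. real (order (of_real y) p) / real (degree p))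
      = real (\<Sum>y | poly p (complex_of_real y) = 0. order (of_real y) p) / real (degree p)"
    by (simp add: sum_divide_distrib)
  also have "\<dots> = 1" using assms(2) by (simp add: sum_order_real_rooted[OF assms(1)] del: of_nat_sum)
  finally show ?thesis by simp
qed

lemma real_distribution_empirical_root_measure:
  assumes "real_rooted p" "degree p > 0"
  shows "real_distribution (empirical_root_measure p)"
proof -
  have s: "sets (empirical_root_measure p) = sets borel" "space (empirical_root_measure p) = UNIV"
    by (simp_all add: empirical_root_measure_def)
  have "prob_space (empirical_root_measure p)"
    by (rule prob_spaceI) (use assms in \<open>simp add: s emeasure_empirical_root_measure_eq_1\<close>)
  then show ?thesis
    using s by (simp add: real_distribution_def real_distribution_axioms_def)
qed

lemma Cauchy_transform_empirical_root_measure: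
  assumes "real_rooted p" "Im z \<noteq> 0"
  shows "Cauchy_transform (empirical_root_measure p) z
    = poly (pderiv p) z / (of_nat (degree p) * poly p z)"
proof -
  have p: "p \<noteq> 0" "poly p z \<noteq> 0" using assms by (auto simp: real_rooted_def)
  have "Cauchy_transform (empirical_root_measure p) z
      = (\<Sum>y | poly p (complex_of_real y) = 0. of_nat (order (of_real y) p) / of_nat (degree p) * (1 / (z - of_real y)))"
    unfolding Cauchy_transform_def by (rule integral_empirical_root_measure) (use p in auto)
  also have "\<dots> = (\<Sum>y | poly p (complex_of_real y) = 0. of_nat (order (of_real y) p) / (z - of_real y)) / of_nat (degree p)"
    by (simp add: sum_divide_distrib field_simps)
  also have "\<dots> = poly (pderiv p) z / poly p z / of_nat (degree p)"
    by (simp add: poly_pderiv_eq_sum_roots[OF p] sum_roots_real_rooted[OF assms(1)])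
  finally show ?thesis by simp
qed

lemma tight_empirical_root_measures:
  assumes "\<And>n. real_rooted (p n)" "\<And>n. degree (p n) > 0"
    and "\<And>n z. poly (p n) z = 0 \<Longrightarrow> norm z \<le> K"
  shows "tight (\<lambda>n. empirical_root_measure (p n))"
  unfolding tight_def
proof (intro conjI allI impI)
  show "real_distribution (empirical_root_measure (p n))" for n
    using assms by (intro real_distribution_empirical_root_measure)
  fix e :: real assume e: "e > 0"
  define L where "L = \<bar>K\<bar> + 1"
  have "measure (empirical_root_measure (p n)) {- L<..L} = 1" for n
  proof -
    have "y \<in> {- L<..L}" if "poly (p n) (complex_of_real y) = 0" for y
      using assms(3)[OF that] by (auto simp: L_def)
    then have "emeasure (empirical_root_measure (p n)) {- L<..L} = 1"
      using assms by (intro emeasure_empirical_root_measure_eq_1) auto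
    then show ?thesis by (simp add: measure_def)
  qed
  moreover have "- L < L" by (simp add: L_def)
  ultimately show "\<exists>a b. a < b \<and> (\<forall>n. 1 - e < measure (empirical_root_measure (p n)) {a<..b})"
    using e by (intro exI[of _ "- L"] exI[of _ L]) auto
qed

lemma Cauchy_transform_weak_limit:
  assumes M: "\<And>n. real_distribution (M n)" "real_distribution N" and w: "weak_conv_m M N"
    and z: "Im z \<noteq> 0"
  shows "(\<lambda>n. Cauchy_transform (M n) z) \<longlonglongrightarrow> Cauchy_transform N z"
  unfolding Cauchy_transform_def
proof (rule weak_conv_imp_integral_bdd_continuous_conv[OF M w])
  show "isCont (\<lambda>t. 1 / (z - complex_of_real t)) t" for t
    using resolvent_nz[OF z] by (intro continuous_intros) auto
  show "norm (1 / (z - complex_of_real t)) \<le> 1 / \<bar>Im z\<bar>" for t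
    by (rule norm_resolvent_le[OF z])
qed

text \<open>By Helly's theorem some subsequence converges; every subsequential limit has Cauchy transform
  \<open>g\<close> on \<open>U\<close>, which leaves only one candidate.\<close>

theorem weak_conv_of_Cauchy_transform:
  assumes tight: "tight M"
    and U: "open U" "U \<noteq> {}" "U \<subseteq> {z. Im z > 0}"
    and lim: "\<And>z. z \<in> U \<Longrightarrow> (\<lambda>n. Cauchy_transform (M n) z) \<longlonglongrightarrow> g z"
  obtains N where "real_distribution N" "weak_conv_m M N" "\<And>z. z \<in> U \<Longrightarrow> Cauchy_transform N z = g z"
proof -
  have M: "real_distribution (M n)" for n using tight by (simp add: tight_def)
  have sub: "Cauchy_transform N z = g z"
    if "strict_mono s" "real_distribution N" "weak_conv_m (M \<circ> s) N" "z \<in> U" for s N z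
  proof (rule LIMSEQ_unique)
    show "(\<lambda>n. Cauchy_transform ((M \<circ> s) n) z) \<longlonglongrightarrow> Cauchy_transform N z"
      by (rule Cauchy_transform_weak_limit[OF _ that(2,3)]) (use that M U in auto)
    show "(\<lambda>n. Cauchy_transform ((M \<circ> s) n) z) \<longlonglongrightarrow> g z"
      using LIMSEQ_subseq_LIMSEQ[OF lim that(1)] that by (simp add: o_def)
  qed
  obtain s N where N: "strict_mono s" "real_distribution N" "weak_conv_m (M \<circ> s) N"
    using tight_imp_convergent_subsubsequence[OF tight strict_mono_id] by auto
  have "weak_conv_m M N"
  proof (rule tight_subseq_weak_converge[OF M N(2) tight])
    fix s' N' assume N': "strict_mono s'" "real_distribution N'" "weak_conv_m (M \<circ> s') N'"
    then have "N' = N"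
      using sub N by (intro Cauchy_transform_unique_open[OF N'(2) N(2) U]) auto
    with N' show "weak_conv_m (M \<circ> s') N" by simp
  qed
  with N sub that show ?thesis by blast
qed

section \<open>Limits of root measures\<close>

lemma real_rooted_monom: "real_rooted (monom 1 n)"
proof -
  have "monom 1 n \<noteq> (0 :: complex poly)" by simp
  then show ?thesis by (auto simp: real_rooted_def poly_monom)
qed

lemma real_rooted_diff_op_funpow:
  assumes "preserves_real_roots h" "n > 0"
  shows "real_rooted ((diff_op h n ^^ m) (monom 1 n))"
  using assms by (induction m) (auto simp: real_rooted_monom preserves_real_roots_def)

lemma degree_diff_op_funpow:
  assumes "fps_nth h 0 = 1"
  shows "degree ((diff_op h n ^^ m) p) = degree p"
  using assms by (induction m) (auto simp: degree_diff_op)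

context small_series begin

text \<open>This is the equation \<open>z = \<theta> R(G z) + 1 / G z\<close> of the measure with \<open>R\<close>-transform \<open>\<theta> R\<close>, together with the
  a priori bound that selects the solution. It is stated far up in the half plane and not on the regions of the
  definition of the \<open>R\<close>-transform, since it passes to weak limits in this form.\<close>

definition solves_fixpoint :: "real \<Rightarrow> real measure \<Rightarrow> bool" where
  "solves_fixpoint \<theta> \<mu> \<longleftrightarrow> real_distribution \<mu> \<and>
     (\<forall>z. Im z > 0 \<longrightarrow> norm z > 2 / \<epsilon> \<longrightarrow> norm (Cauchy_transform \<mu> z) \<le> \<epsilon> \<and>
        Cauchy_transform \<mu> z = 1 / (z - of_real \<theta> * Rf (Cauchy_transform \<mu> z)))"

text \<open>Since \<open>a\<^sub>n' = n a\<^bsub>n-1\<^esub>\<close>, the logarithmic derivative of \<open>p = a\<^sub>n\<close>, divided by \<open>n\<close>, is the last of the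
  ratios estimated in \<open>ratio_estimate\<close>.\<close>

lemma root_bound_and_log_deriv:
  assumes h: "neg_log_deriv h R" "\<And>j. fps_nth R j = r j"
    and mn: "0 < n" "m \<le> n" and z: "norm z \<ge> 2 / \<epsilon>"
    and U: "norm U \<le> \<epsilon>" "U = 1 / (z - of_real (m / n) * Rf U)"
  defines "p \<equiv> (diff_op h n ^^ m) (monom 1 n)"
  shows "poly p z \<noteq> 0" "norm (poly (pderiv p) z / (of_nat n * poly p z) - U) \<le> 1 / real n"
proof -
  define a where "a k = poly (diff_op (h ^ m) n (monom 1 k)) z" for k
  define k where "k = n - 1"
  have n: "n = Suc k" using mn by (simp add: k_def)
  have rec: "a (Suc i) = z * a i - of_real (m / n) *
      (\<Sum>j\<le>i. r j / of_nat n ^ j * (fact i / fact (i - j)) * a (i - j))" for i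
    unfolding a_def diff_op_monom_recurrence[OF neg_log_deriv_power[OF h(1)]]
    by (simp add: h(2) sum_distrib_left mult_ac del: of_nat_Suc)
  have a0: "a 0 = 1"
    using h(1) by (simp add: a_def diff_op_def degree_monom_eq neg_log_deriv_def monom_0 fps_nth_power_0)
  have "a (Suc k) \<noteq> 0 \<and> norm (a k / a (Suc k)) \<le> \<epsilon> \<and> norm (a k / a (Suc k) - U) \<le> (real n - real k) / real n"
    by (rule ratio_estimate[OF z _ _ U a0 rec]) (use mn n in auto)
  moreover have "poly p z = a (Suc k)" "poly (pderiv p) z = of_nat n * a k"
    by (simp_all add: p_def a_def n diff_op_funpow pderiv_diff_op_monom del: of_nat_Suc)
  moreover have "of_nat n \<noteq> (0 :: complex)" using mn by simp
  ultimately show "poly p z \<noteq> 0" "norm (poly (pderiv p) z / (of_nat n * poly p z) - U) \<le> 1 / real n"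
    by (auto simp: n)
qed

lemma Cauchy_transform_left_inverse:
  assumes "solves_fixpoint \<theta> \<mu>" "0 \<le> \<theta>" "\<theta> \<le> 1" "Im w > 2 / \<epsilon>"
  shows "norm (Cauchy_transform \<mu> w) \<le> \<epsilon>" "Cauchy_transform \<mu> w \<noteq> 0"
    "of_real \<theta> * Rf (Cauchy_transform \<mu> w) + 1 / Cauchy_transform \<mu> w = w"
proof -
  have "2 / \<epsilon> > 0" using \<epsilon> by simp
  then have w: "Im w > 0" "norm w > 2 / \<epsilon>" using assms(4) abs_Im_le_cmod[of w] by linarith+
  let ?u = "Cauchy_transform \<mu> w"
  have u: "norm ?u \<le> \<epsilon>" "?u = 1 / (w - of_real \<theta> * Rf ?u)"
    using assms(1) w by (auto simp: solves_fixpoint_def)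
  show "norm ?u \<le> \<epsilon>" by (rule u(1))
  have "w - of_real \<theta> * Rf ?u \<noteq> 0"
    using norm_inverse_le(1)[OF denominator_ge[OF less_imp_le[OF w(2)] assms(2,3) Rf_bound[OF u(1)]]] .
  then show "?u \<noteq> 0" by (subst u(2)) simp
  have "1 / ?u = w - of_real \<theta> * Rf ?u"
    using arg_cong[OF u(2), of "\<lambda>x. 1 / x"] by simp
  then show "of_real \<theta> * Rf ?u + 1 / ?u = w" by simp
qed

lemma solves_fixpoint_unique:
  assumes \<mu>: "solves_fixpoint \<theta> \<mu>" and \<nu>: "solves_fixpoint \<theta> \<nu>" and \<theta>: "0 \<le> \<theta>" "\<theta> \<le> 1"
  shows "\<mu> = \<nu>"
proof (rule Cauchy_transform_unique_open[where U = "{z. Im z > 2 / \<epsilon>}"])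
  show "Cauchy_transform \<mu> z = Cauchy_transform \<nu> z" if "z \<in> {z. Im z > 2 / \<epsilon>}" for z
  proof -
    have z: "Im z > 2 / \<epsilon>" using that by simp
    note u = Cauchy_transform_left_inverse[OF \<mu> \<theta> z] and v = Cauchy_transform_left_inverse[OF \<nu> \<theta> z]
    have "1 / Cauchy_transform \<mu> z + of_real \<theta> * Rf (Cauchy_transform \<mu> z)
        = 1 / Cauchy_transform \<nu> z + of_real \<theta> * Rf (Cauchy_transform \<nu> z)"
      by (subst (1 2) add.commute) (simp only: u(3) v(3))
    then show ?thesis by (rule fixpoint_unique[OF u(1) v(1) u(2) v(2) \<theta>])
  qed
  show "{z. Im z > 2 / \<epsilon>} \<noteq> {}"
    by (auto intro!: exI[of _ "Complex 0 (2 / \<epsilon> + 1)"])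
  have "2 / \<epsilon> > 0" using \<epsilon> by simp
  then show "{z. Im z > 2 / \<epsilon>} \<subseteq> {z. Im z > 0}" by (intro Collect_mono impI) linarith
  show "real_distribution \<mu>" "real_distribution \<nu>" using \<mu> \<nu> by (auto simp: solves_fixpoint_def)
qed (rule open_halfspace_Im_gt)

text \<open>The exponent and the degree are kept in the exact proportion \<open>k / q\<close>, so that \<open>\<theta>\<close> and with it the
  fixed point \<open>U z\<close> are constant along the sequence.\<close>

lemma exists_weak_limit:
  assumes h: "neg_log_deriv h R" "\<And>j. fps_nth R j = r j" "preserves_real_roots h"
    and k: "k \<le> q" "0 < q"
  obtains \<mu> where "solves_fixpoint (k / q) \<mu>"
    "weak_conv_m (\<lambda>l. empirical_root_measure ((diff_op h (q * Suc l) ^^ (k * Suc l)) (monom 1 (q * Suc l)))) \<mu>"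
proof -
  define n where "n l = q * Suc l" for l
  define m where "m l = k * Suc l" for l
  define p where "p l = (diff_op h (n l) ^^ m l) (monom 1 (n l))" for l
  have mn: "0 < n l" "m l \<le> n l" for l using k by (auto simp: n_def m_def simp del: mult_Suc_right)
  have \<theta>: "real (m l) / real (n l) = k / q" for l
    using k by (simp add: m_def n_def del: mult_Suc_right of_nat_Suc)
  have \<theta>01: "0 \<le> real k / real q" "real k / real q \<le> 1" using k by auto
  have h0: "fps_nth h 0 = 1" using h(1) by (simp add: neg_log_deriv_def)
  have rr: "real_rooted (p l)" for l
    unfolding p_def by (rule real_rooted_diff_op_funpow[OF h(3) mn(1)])
  have deg: "degree (p l) = n l" for l
    unfolding p_def degree_diff_op_funpow[OF h0] by (simp add: degree_monom_eq)
  have ex: "\<exists>U. norm U \<le> \<epsilon> \<and> U = 1 / (z - of_real (k / q) * Rf U)" if "norm z \<ge> 2 / \<epsilon>" for z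
    by (rule fixpoint_exists[OF that \<theta>01]) blast
  define U where "U z = (SOME U. norm U \<le> \<epsilon> \<and> U = 1 / (z - of_real (k / q) * Rf U))" for z
  have U: "norm (U z) \<le> \<epsilon> \<and> U z = 1 / (z - of_real (k / q) * Rf (U z))" if "norm z \<ge> 2 / \<epsilon>" for z
    unfolding U_def by (rule someI_ex[OF ex[OF that]])
  have nz: "poly (p l) z \<noteq> 0"
    and est: "norm (poly (pderiv (p l)) z / (of_nat (n l) * poly (p l) z) - U z) \<le> 1 / real (n l)"
    if "norm z \<ge> 2 / \<epsilon>" for l z
    using root_bound_and_log_deriv[OF h(1,2) mn that, of "U z" l] U[OF that] unfolding p_def \<theta> by auto
  have tight: "tight (\<lambda>l. empirical_root_measure (p l))"
  proof (rule tight_empirical_root_measures[where K = "2 / \<epsilon>"])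
    show "norm z \<le> 2 / \<epsilon>" if "poly (p l) z = 0" for l z using nz[of z l] that by fastforce
  qed (use rr deg mn in auto)
  define V where "V = {z. Im z > 0} \<inter> {z. norm z > 2 / \<epsilon>}"
  have V: "open V" "V \<noteq> {}" "V \<subseteq> {z. Im z > 0}"
  proof -
    show "open V" unfolding V_def
      by (intro open_Int open_halfspace_Im_gt open_Collect_less continuous_intros)
    have "Complex 0 (2 / \<epsilon> + 1) \<in> V" using \<epsilon> by (auto simp: V_def cmod_def add_pos_pos)
    then show "V \<noteq> {}" by blast
  qed (auto simp: V_def)
  have lim: "(\<lambda>l. Cauchy_transform (empirical_root_measure (p l)) z) \<longlonglongrightarrow> U z" if "z \<in> V" for z
  proof -
    have z: "Im z \<noteq> 0" "norm z \<ge> 2 / \<epsilon>" using that by (auto simp: V_def)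
    have "(\<lambda>l. Cauchy_transform (empirical_root_measure (p l)) z - U z) \<longlonglongrightarrow> 0"
    proof (rule Lim_null_comparison)
      show "\<forall>\<^sub>F l in sequentially. norm (Cauchy_transform (empirical_root_measure (p l)) z - U z)
          \<le> inverse (real (Suc l))"
      proof (rule always_eventually, rule allI)
        fix l
        have "real (Suc l) \<le> real (n l)" using k by (simp add: n_def del: mult_Suc_right of_nat_Suc)
        then have "1 / real (n l) \<le> inverse (real (Suc l))"
          unfolding inverse_eq_divide by (intro divide_left_mono) auto
        then show "norm (Cauchy_transform (empirical_root_measure (p l)) z - U z) \<le> inverse (real (Suc l))"
          using est[OF z(2), of l]
          by (simp add: Cauchy_transform_empirical_root_measure[OF rr z(1)] deg)
      qed
    qed (rule LIMSEQ_inverse_real_of_nat)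
    then show ?thesis by (simp add: LIM_zero_iff)
  qed
  obtain \<mu> where \<mu>: "real_distribution \<mu>" "weak_conv_m (\<lambda>l. empirical_root_measure (p l)) \<mu>"
      "\<And>z. z \<in> V \<Longrightarrow> Cauchy_transform \<mu> z = U z"
    by (rule weak_conv_of_Cauchy_transform[OF tight V lim]) (assumption, rule that)
  have "solves_fixpoint (k / q) \<mu>"
    unfolding solves_fixpoint_def
  proof (intro conjI allI impI \<mu>(1))
    fix z assume "Im z > 0" "norm z > 2 / \<epsilon>"
    then have "Cauchy_transform \<mu> z = U z" "norm z \<ge> 2 / \<epsilon>" using \<mu>(3) by (auto simp: V_def)
    with U[of z] show "norm (Cauchy_transform \<mu> z) \<le> \<epsilon>"
      "Cauchy_transform \<mu> z = 1 / (z - of_real (k / q) * Rf (Cauchy_transform \<mu> z))" by auto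
  qed
  with \<mu>(2) that show ?thesis unfolding p_def n_def m_def by blast
qed

section \<open>R-transforms and free convolution of the limits\<close>

lemma norm_theta_Rf_le:
  assumes "0 \<le> \<theta>" "\<theta> \<le> 1" "norm u \<le> \<epsilon>"
  shows "norm (of_real \<theta> * Rf u) \<le> 2 * C"
proof -
  have "norm (of_real \<theta> * Rf u) \<le> 1 * (2 * C)"
    unfolding norm_mult using assms Rf_bound by (intro mult_mono) auto
  then show ?thesis by simp
qed

lemma Cauchy_transform_right_inverse:
  assumes \<mu>: "solves_fixpoint \<theta> \<mu>" and \<theta>: "0 \<le> \<theta>" "\<theta> \<le> 1" and z: "norm z \<le> \<epsilon>" "z \<noteq> 0"
    and w: "Im (of_real \<theta> * Rf z + 1 / z) > 2 / \<epsilon>"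
  shows "Cauchy_transform \<mu> (of_real \<theta> * Rf z + 1 / z) = z"
proof -
  define u where "u = Cauchy_transform \<mu> (of_real \<theta> * Rf z + 1 / z)"
  note u = Cauchy_transform_left_inverse[OF \<mu> \<theta> w, folded u_def]
  have "1 / u + of_real \<theta> * Rf u = 1 / z + of_real \<theta> * Rf z"
    by (subst (1 2) add.commute) (rule u(3))
  then have "u = z" by (rule fixpoint_unique[OF u(1) z(1) u(2) z(2) \<theta>])
  then show ?thesis by (simp add: u_def)
qed

lemma Delta_region_small:
  assumes "z \<in> Delta_region \<alpha> \<beta>" "\<beta> \<ge> 2 / \<epsilon>"
  shows "z \<noteq> 0" "norm z < \<epsilon>" "Im (1 / z) > \<beta>"
proof -
  have pos: "2 / \<epsilon> > 0" using \<epsilon> by simp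
  have Im: "Im (inverse z) > \<beta>" using assms by (simp add: Delta_region_def Gamma_region_def)
  moreover have "\<beta> > 0" using assms(2) pos by linarith
  ultimately show "z \<noteq> 0" "Im (1 / z) > \<beta>" by (auto simp: inverse_eq_divide)
  have "norm (inverse z) > 2 / \<epsilon>" using Im assms(2) abs_Im_le_cmod[of "inverse z"] by linarith
  then have "2 * norm z < \<epsilon>" using \<open>z \<noteq> 0\<close> \<epsilon> unfolding norm_inverse by (simp add: field_simps)
  then show "norm z < \<epsilon>" using norm_ge_zero[of z] by linarith
qed

text \<open>The series \<open>R\<close> is bounded on the disc, so near \<open>0\<close> the point \<open>T z + 1 / z\<close> lies as far up as
  \<open>1 / z\<close>, apart from a constant. For this reason one \<open>\<beta>\<close> works for every \<open>\<alpha>\<close>.\<close>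

lemma has_R_transform_solves_fixpoint:
  assumes \<mu>: "solves_fixpoint \<theta> \<mu>" and \<theta>: "0 \<le> \<theta>" "\<theta> \<le> 1"
    and T: "\<And>u. norm u \<le> \<epsilon> \<Longrightarrow> T u = of_real \<theta> * Rf u"
  shows "has_R_transform \<mu> T"
  unfolding has_R_transform_def
proof (intro allI impI)
  fix \<alpha> :: real assume "\<alpha> > 0"
  define \<beta> where "\<beta> = 2 / \<epsilon> + 2 * C"
  have \<beta>: "\<beta> > 0" "\<beta> \<ge> 2 / \<epsilon>" using \<epsilon> nonneg by (auto simp: \<beta>_def add_pos_nonneg)
  show "\<exists>\<beta>>0. T analytic_on Delta_region \<alpha> \<beta> \<and>
      (\<forall>z\<in>Delta_region \<alpha> \<beta>. 0 < Im (T z + 1 / z) \<and> Cauchy_transform \<mu> (T z + 1 / z) = z) \<and>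
      (\<forall>z\<in>Gamma_region \<alpha> \<beta>. T (Cauchy_transform \<mu> z) + 1 / Cauchy_transform \<mu> z = z)"
  proof (intro exI[of _ \<beta>] conjI ballI \<beta>(1))
    have "T holomorphic_on ball 0 \<epsilon>"
      by (rule holomorphic_transform[of "\<lambda>u. of_real \<theta> * Rf u"])
         (auto intro!: holomorphic_intros Rf_holomorphic simp: T)
    then have "T analytic_on ball 0 \<epsilon>" by (simp add: analytic_on_open)
    moreover have "Delta_region \<alpha> \<beta> \<subseteq> ball 0 \<epsilon>" using Delta_region_small[OF _ \<beta>(2)] by auto
    ultimately show "T analytic_on Delta_region \<alpha> \<beta>" by (rule analytic_on_subset)
  next
    fix z assume "z \<in> Delta_region \<alpha> \<beta>"
    note z = Delta_region_small[OF this \<beta>(2)]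
    have Tz: "T z = of_real \<theta> * Rf z" using z by (intro T) auto
    have "\<bar>Im (of_real \<theta> * Rf z)\<bar> \<le> 2 * C"
      by (rule order_trans[OF abs_Im_le_cmod norm_theta_Rf_le[OF \<theta>]]) (use z in auto)
    then have Im: "Im (of_real \<theta> * Rf z + 1 / z) > 2 / \<epsilon>"
      using z(3) by (simp add: \<beta>_def)
    have "2 / \<epsilon> > 0" using \<epsilon> by simp
    with Im show "0 < Im (T z + 1 / z)" unfolding Tz by linarith
    show "Cauchy_transform \<mu> (T z + 1 / z) = z"
      unfolding Tz using z Im by (intro Cauchy_transform_right_inverse[OF \<mu> \<theta>]) auto
  next
    fix z assume "z \<in> Gamma_region \<alpha> \<beta>"
    then have "Im z > 2 / \<epsilon>" using \<beta> by (simp add: Gamma_region_def)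
    from Cauchy_transform_left_inverse[OF \<mu> \<theta> this]
    show "T (Cauchy_transform \<mu> z) + 1 / Cauchy_transform \<mu> z = z" by (simp add: T)
  qed
qed

text \<open>The free convolution is defined through arbitrary \<open>R\<close>-transforms of the two factors, hence the need to know that
  they agree with the power series near \<open>0\<close>. Given \<open>z\<close> in \<open>\<Delta>\<^bsub>1,\<beta>\<^esub>\<close> put \<open>w = \<theta> R(z) + 1 / z\<close>. Then \<open>G w = z\<close>, and \<open>w\<close> lies
  in the slightly wider cone \<open>\<Gamma>\<^bsub>2,\<beta>'\<^esub>\<close>, where \<open>S\<close> is known to satisfy \<open>S(G w) + 1 / G w = w\<close>.\<close>

lemma has_R_transform_determined:
  assumes \<mu>: "solves_fixpoint \<theta> \<mu>" and \<theta>: "0 \<le> \<theta>" "\<theta> \<le> 1" and S: "has_R_transform \<mu> S"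
  obtains \<beta> where "\<beta> > 0" "\<And>z. z \<in> Delta_region 1 \<beta> \<Longrightarrow> S z = of_real \<theta> * Rf z"
proof -
  obtain \<beta>' where \<beta>': "\<beta>' > 0"
      "\<And>w. w \<in> Gamma_region 2 \<beta>' \<Longrightarrow> S (Cauchy_transform \<mu> w) + 1 / Cauchy_transform \<mu> w = w"
    using S[unfolded has_R_transform_def, rule_format, of 2] by auto
  have pos: "2 / \<epsilon> > 0" using \<epsilon> by simp
  define \<beta> where "\<beta> = \<beta>' + 2 / \<epsilon> + 6 * C"
  have "S z = of_real \<theta> * Rf z" if z: "z \<in> Delta_region 1 \<beta>" for z
  proof -
    have "\<beta> \<ge> 2 / \<epsilon>" using \<beta>'(1) nonneg by (simp add: \<beta>_def)
    note small = Delta_region_small[OF z this]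
    define e where "e = of_real \<theta> * Rf z"
    define w where "w = e + 1 / z"
    have "norm e \<le> 2 * C" unfolding e_def using small by (intro norm_theta_Rf_le[OF \<theta>]) auto
    then have e: "\<bar>Im e\<bar> \<le> 2 * C" "\<bar>Re e\<bar> \<le> 2 * C"
      using abs_Im_le_cmod[of e] abs_Re_le_cmod[of e] by linarith+
    have rez: "\<bar>Re (1 / z)\<bar> < Im (1 / z)" "Im (1 / z) > \<beta>"
      using z by (auto simp: Delta_region_def Gamma_region_def inverse_eq_divide)
    have reim: "Im w = Im e + Im (1 / z)" "Re w = Re e + Re (1 / z)" by (simp_all add: w_def)
    have Imw: "Im w > \<beta>' + 2 / \<epsilon> + 4 * C" using reim e rez(2) unfolding \<beta>_def by linarith
    have "\<bar>Re w\<bar> < 2 * Im w"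
      using reim e rez(1) Imw \<beta>'(1) pos nonneg by linarith
    moreover have "Im w > \<beta>'" using Imw pos nonneg by linarith
    ultimately have "w \<in> Gamma_region 2 \<beta>'" by (simp add: Gamma_region_def)
    then have "S (Cauchy_transform \<mu> w) + 1 / Cauchy_transform \<mu> w = w" by (rule \<beta>')
    moreover have "Cauchy_transform \<mu> w = z"
      unfolding w_def e_def
      by (rule Cauchy_transform_right_inverse[OF \<mu> \<theta>])
         (use small Imw \<beta>'(1) nonneg in \<open>auto simp: w_def e_def\<close>)
    ultimately show ?thesis by (simp add: w_def e_def)
  qed
  moreover have "\<beta> > 0" using \<beta>'(1) pos nonneg unfolding \<beta>_def by linarith
  ultimately show ?thesis using that by blast
qed

text \<open>Uniqueness of the convolution: if \<open>\<rho>\<close> has the \<open>R\<close>-transform \<open>R + S\<close>, then for \<open>w\<close> high up in a narrow cone the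
  point \<open>z = G\<^sub>\<mu> w\<close> lies in \<open>\<Delta>\<^bsub>1,\<beta>\<^esub>\<close>, where \<open>R + S\<close> is the series. So \<open>w = R z + S z + 1 / z\<close>, whence \<open>G\<^sub>\<rho> w = z = G\<^sub>\<mu> w\<close>
  on an open set.\<close>

lemma free_conv_solves_fixpoint:
  assumes \<nu>: "solves_fixpoint \<theta> \<nu>" and \<kappa>: "solves_fixpoint \<eta> \<kappa>" and \<mu>: "solves_fixpoint (\<theta> + \<eta>) \<mu>"
    and \<theta>: "0 \<le> \<theta>" "0 \<le> \<eta>" "\<theta> + \<eta> \<le> 1"
  shows "free_conv \<nu> \<kappa> = \<mu>"
  unfolding free_conv_def
proof (rule the_equality)
  have \<mu>d: "real_distribution \<mu>" using \<mu> by (simp add: solves_fixpoint_def)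
  have "has_R_transform \<nu> (\<lambda>u. of_real \<theta> * Rf u)" "has_R_transform \<kappa> (\<lambda>u. of_real \<eta> * Rf u)"
    using \<theta> by (auto intro!: has_R_transform_solves_fixpoint[OF \<nu>] has_R_transform_solves_fixpoint[OF \<kappa>])
  moreover have "has_R_transform \<mu> (\<lambda>u. of_real \<theta> * Rf u + of_real \<eta> * Rf u)"
    using \<theta> by (intro has_R_transform_solves_fixpoint[OF \<mu>]) (auto simp: algebra_simps)
  ultimately show "real_distribution \<mu> \<and> (\<exists>R S. has_R_transform \<nu> R \<and> has_R_transform \<kappa> S \<and>
      has_R_transform \<mu> (\<lambda>z. R z + S z))" using \<mu>d by blast
  fix \<rho> assume "real_distribution \<rho> \<and> (\<exists>R S. has_R_transform \<nu> R \<and> has_R_transform \<kappa> S \<and>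
      has_R_transform \<rho> (\<lambda>z. R z + S z))"
  then obtain R S where \<rho>: "real_distribution \<rho>" "has_R_transform \<nu> R" "has_R_transform \<kappa> S"
      "has_R_transform \<rho> (\<lambda>z. R z + S z)" by blast
  have "\<theta> \<le> 1" "\<eta> \<le> 1" using \<theta> by auto
  obtain \<beta>1 where \<beta>1: "\<beta>1 > 0" "\<And>z. z \<in> Delta_region 1 \<beta>1 \<Longrightarrow> R z = of_real \<theta> * Rf z"
    using has_R_transform_determined[OF \<nu> \<theta>(1) \<open>\<theta> \<le> 1\<close> \<rho>(2)] by blast
  obtain \<beta>2 where \<beta>2: "\<beta>2 > 0" "\<And>z. z \<in> Delta_region 1 \<beta>2 \<Longrightarrow> S z = of_real \<eta> * Rf z"
    using has_R_transform_determined[OF \<kappa> \<theta>(2) \<open>\<eta> \<le> 1\<close> \<rho>(3)] by blast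
  obtain \<beta>3 where \<beta>3: "\<beta>3 > 0"
      "\<And>z. z \<in> Delta_region 1 \<beta>3 \<Longrightarrow> Cauchy_transform \<rho> (R z + S z + 1 / z) = z"
    using \<rho>(4)[unfolded has_R_transform_def, rule_format, of 1] by auto
  have pos: "2 / \<epsilon> > 0" using \<epsilon> by simp
  define \<beta> where "\<beta> = \<beta>1 + \<beta>2 + \<beta>3 + 2 / \<epsilon> + 8 * C"
  define V where "V = {w. \<bar>Re w\<bar> < Im w / 2} \<inter> {w. Im w > \<beta>}"
  have \<beta>: "\<beta> > 0" using \<beta>1(1) \<beta>2(1) \<beta>3(1) pos nonneg unfolding \<beta>_def by linarith
  show "\<rho> = \<mu>"
  proof (rule Cauchy_transform_unique_open[OF \<rho>(1) \<mu>d])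
    show "open V" unfolding V_def
      by (intro open_Int open_halfspace_Im_gt open_Collect_less continuous_intros) auto
    have "Complex 0 (\<beta> + 1) \<in> V" using \<beta> by (auto simp: V_def)
    then show "V \<noteq> {}" by blast
    show "V \<subseteq> {z. Im z > 0}" using \<beta> by (auto simp: V_def)
    fix w assume w: "w \<in> V"
    have \<theta>': "0 \<le> \<theta> + \<eta>" using \<theta> by simp
    have Imw: "Im w > \<beta>1 + \<beta>2 + \<beta>3 + 2 / \<epsilon> + 8 * C" "\<bar>Re w\<bar> < Im w / 2"
      using w by (auto simp: V_def \<beta>_def)
    then have "Im w > 2 / \<epsilon>" using \<beta>1(1) \<beta>2(1) \<beta>3(1) nonneg by linarith
    note inv = Cauchy_transform_left_inverse[OF \<mu> \<theta>' \<theta>(3) this]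
    define z where "z = Cauchy_transform \<mu> w"
    define e where "e = of_real (\<theta> + \<eta>) * Rf z"
    have "norm e \<le> 2 * C" unfolding e_def using inv by (intro norm_theta_Rf_le[OF \<theta>' \<theta>(3)]) (auto simp: z_def)
    then have e: "\<bar>Im e\<bar> \<le> 2 * C" "\<bar>Re e\<bar> \<le> 2 * C"
      using abs_Im_le_cmod[of e] abs_Re_le_cmod[of e] by linarith+
    have sum: "e + 1 / z = w" using inv(3) by (simp add: z_def e_def)
    have iz: "Im (inverse z) = Im w - Im e" "Re (inverse z) = Re w - Re e"
      by (simp_all add: sum[symmetric] inverse_eq_divide)
    have "Im (inverse z) > \<beta>1 + \<beta>2 + \<beta>3" "\<bar>Re (inverse z)\<bar> < Im (inverse z)"
      using iz e Imw \<beta>1(1) \<beta>2(1) \<beta>3(1) pos nonneg by linarith+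
    then have z: "z \<in> Delta_region 1 \<beta>1" "z \<in> Delta_region 1 \<beta>2" "z \<in> Delta_region 1 \<beta>3"
      using \<beta>1(1) \<beta>2(1) \<beta>3(1) by (auto simp: Delta_region_def Gamma_region_def)
    have "R z + S z + 1 / z = w"
      using sum by (simp add: \<beta>1(2)[OF z(1)] \<beta>2(2)[OF z(2)] e_def algebra_simps)
    then show "Cauchy_transform \<rho> w = Cauchy_transform \<mu> w"
      using \<beta>3(2)[OF z(3)] by (simp add: z_def)
  qed
qed

text \<open>The measures with \<open>\<theta> = k / n\<close> for \<open>k \<le> n\<close> interpolate between the \<open>n\<close>-th root and \<open>\<mu>\<close>.\<close>

lemma freely_infinitely_divisible_solves_fixpoint:
  assumes h: "neg_log_deriv h R" "\<And>j. fps_nth R j = r j" "preserves_real_roots h"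
    and \<mu>: "solves_fixpoint 1 \<mu>"
  shows "freely_infinitely_divisible \<mu>"
  unfolding freely_infinitely_divisible_def
proof (intro conjI allI impI)
  show "real_distribution \<mu>" using \<mu> by (simp add: solves_fixpoint_def)
  fix n :: nat assume n: "1 \<le> n"
  have "\<exists>\<nu>. solves_fixpoint (real k / real n) \<nu>" if "k \<le> n" for k
    by (rule exists_weak_limit[OF h that]) (use n in auto)
  note ex = this
  define \<nu> where "\<nu> k = (SOME \<nu>. solves_fixpoint (real k / real n) \<nu>)" for k
  have \<nu>: "solves_fixpoint (real k / real n) (\<nu> k)" if "k \<le> n" for k
    unfolding \<nu>_def by (rule someI_ex[OF ex[OF that]])
  have "(free_conv (\<nu> 1) ^^ k) (\<nu> 1) = \<nu> (Suc k)" if "k < n" for k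
    using that
  proof (induction k)
    case (Suc k)
    have "free_conv (\<nu> 1) (\<nu> (Suc k)) = \<nu> (Suc (Suc k))"
    proof (rule free_conv_solves_fixpoint)
      show "solves_fixpoint (real 1 / real n) (\<nu> 1)" by (rule \<nu>) (use n in auto)
      show "solves_fixpoint (real (Suc k) / real n) (\<nu> (Suc k))" by (rule \<nu>) (use Suc in auto)
      have "real 1 / real n + real (Suc k) / real n = real (Suc (Suc k)) / real n"
        by (simp add: add_divide_distrib)
      then show "solves_fixpoint (real 1 / real n + real (Suc k) / real n) (\<nu> (Suc (Suc k)))"
        "real 1 / real n + real (Suc k) / real n \<le> 1"
        using \<nu>[of "Suc (Suc k)"] Suc by auto
    qed auto
    with Suc show ?case by simp
  qed auto
  then have "free_conv_power (\<nu> 1) n = \<nu> n" using n by (simp add: free_conv_power_def)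
  also have "solves_fixpoint 1 (\<nu> n)" using \<nu>[of n] n by simp
  then have "\<nu> n = \<mu>" by (rule solves_fixpoint_unique[OF _ \<mu>]) auto
  finally have "free_conv_power (\<nu> 1) n = \<mu>" .
  moreover have "real_distribution (\<nu> 1)" using \<nu>[of 1] n by (simp add: solves_fixpoint_def)
  ultimately show "\<exists>\<nu>n. real_distribution \<nu>n \<and> free_conv_power \<nu>n n = \<mu>" by blast
qed

end

section \<open>Products of genus one factors\<close>

definition genus1_factor :: "real \<Rightarrow> complex \<Rightarrow> complex" where
  "genus1_factor t z = (1 - of_real t * z) * exp (of_real t * z)"

lemma norm_genus1_factor_minus_one_le:
  assumes "norm (of_real t * z) \<le> 1 / 2"
  shows "norm (genus1_factor t z - 1) \<le> 3 * (t\<^sup>2 * (norm z)\<^sup>2)"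
  using weierstrass_factor_bound[OF assms, of 1]
  by (simp add: genus1_factor_def weierstrass_factor_def norm_mult power2_abs flip: power2_eq_square power_mult_distrib)
     (simp add: power_mult_distrib)

definition genus1_fps :: "real \<Rightarrow> complex fps" where
  "genus1_fps t = (1 - fps_const (of_real t) * fps_X) * fps_exp (of_real t)"

lemma genus1_factor_has_fps_expansion: "genus1_factor t has_fps_expansion genus1_fps t"
  unfolding genus1_factor_def genus1_fps_def by (intro fps_expansion_intros)

lemma neg_log_deriv_genus1:
  "neg_log_deriv (genus1_fps t) (Abs_fps (\<lambda>k. if k = 0 then 0 else of_real (t ^ (k + 1))))"
proof -
  have "neg_log_deriv (genus1_fps t) (Abs_fps (\<lambda>k. of_real t ^ (k + 1)) + fps_const (- of_real t))"
    unfolding genus1_fps_def by (intro neg_log_deriv_mult neg_log_deriv_linear neg_log_deriv_exp)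
  also have "Abs_fps (\<lambda>k. of_real t ^ (k + 1)) + fps_const (- of_real t)
      = Abs_fps (\<lambda>k. if k = 0 then 0 else complex_of_real (t ^ (k + 1)))"
    by (rule fps_ext) auto
  finally show ?thesis .
qed

locale square_summable =
  fixes t :: "nat \<Rightarrow> real"
  assumes summable_sq: "summable (\<lambda>j. (t j)\<^sup>2)"
begin

text \<open>A bound for the \<open>|t j|\<close>. Taking it to be at least \<open>1\<close> allows lower powers of it to be replaced by higher ones.\<close>

definition B where "B = (SOME B. B \<ge> 1 \<and> (\<forall>j. \<bar>t j\<bar> \<le> B))"

lemma B: "B \<ge> 1" "\<bar>t j\<bar> \<le> B"
proof -
  have "(t j)\<^sup>2 \<le> suminf (\<lambda>j. (t j)\<^sup>2)" for j
    using sum_le_suminf[OF summable_sq, of "{j}"] by simp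
  then have "\<bar>t j\<bar> \<le> sqrt (suminf (\<lambda>j. (t j)\<^sup>2))" for j
    using real_sqrt_le_mono[of "(t j)\<^sup>2"] by simp
  then have "\<exists>B. B \<ge> 1 \<and> (\<forall>j. \<bar>t j\<bar> \<le> B)"
    by (intro exI[of _ "max 1 (sqrt (suminf (\<lambda>j. (t j)\<^sup>2)))"]) (auto simp: le_max_iff_disj)
  from someI_ex[OF this] show "B \<ge> 1" "\<bar>t j\<bar> \<le> B" unfolding B_def by auto
qed

text \<open>The coefficients of the negative logarithmic derivative of \<open>\<Prod>(1 - t\<^sub>j z) e\<^bsup>t\<^sub>j z\<^esup>\<close>. The exponential
  factors remove exactly the first power sum, which need not converge.\<close>

definition power_sum :: "nat \<Rightarrow> real" where
  "power_sum k = (\<Sum>j. if k = 0 then 0 else t j ^ (k + 1))"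

lemma power_le: "k > 0 \<Longrightarrow> \<bar>t j ^ (k + 1)\<bar> \<le> B ^ k * (t j)\<^sup>2"
proof -
  assume "k > 0"
  then obtain i where k: "k = Suc i" by (cases k) auto
  have "\<bar>t j ^ (k + 1)\<bar> = \<bar>t j\<bar> ^ i * (t j)\<^sup>2"
    by (simp add: k power_abs abs_mult power2_eq_square)
  also have "\<dots> \<le> B ^ k * (t j)\<^sup>2"
  proof (rule mult_right_mono)
    have "\<bar>t j\<bar> ^ i \<le> B ^ i" by (intro power_mono B) auto
    also have "\<dots> \<le> B ^ k" unfolding k by (intro power_increasing B) auto
    finally show "\<bar>t j\<bar> ^ i \<le> B ^ k" .
  qed auto
  finally show ?thesis .
qed

lemma summable_power: "summable (\<lambda>j. if k = 0 then 0 else t j ^ (k + 1))"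
proof (cases "k = 0")
  case False
  have "summable (\<lambda>j. t j ^ (k + 1))"
    by (rule summable_comparison_test[OF _ summable_mult[OF summable_sq, of "B ^ k"]])
       (use power_le False in auto)
  then show ?thesis using False by simp
qed simp

lemma power_sum_bound: "\<bar>power_sum k\<bar> \<le> (\<Sum>j. (t j)\<^sup>2) * B ^ k"
proof (cases "k = 0")
  case True
  then show ?thesis by (simp add: power_sum_def suminf_nonneg[OF summable_sq])
next
  case False
  have s: "summable (\<lambda>j. \<bar>t j ^ (k + 1)\<bar>)"
    by (rule summable_comparison_test[OF _ summable_mult[OF summable_sq, of "B ^ k"]])
       (use power_le False in auto)
  have "\<bar>power_sum k\<bar> \<le> (\<Sum>j. \<bar>t j ^ (k + 1)\<bar>)"
    using False summable_rabs[OF s] by (simp add: power_sum_def)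
  also have "\<dots> \<le> (\<Sum>j. B ^ k * (t j)\<^sup>2)"
    using False by (intro suminf_le power_le s summable_mult summable_sq) auto
  also have "\<dots> = B ^ k * (\<Sum>j. (t j)\<^sup>2)" by (rule suminf_mult[OF summable_sq])
  finally show ?thesis by (simp add: mult.commute)
qed

definition genus1_prod :: "complex \<Rightarrow> complex" where
  "genus1_prod z = prodinf (\<lambda>j. genus1_factor (t j) z)"

lemma norm_t_times_le:
  fixes z :: complex
  shows "norm z \<le> 1 / (2 * B) \<Longrightarrow> norm (of_real (t j) * z) \<le> 1 / 2"
proof -
  assume z: "norm z \<le> 1 / (2 * B)"
  have "norm (of_real (t j) * z) \<le> B * (1 / (2 * B))"
    unfolding norm_mult norm_of_real using z B(2)[of j] B(1) by (intro mult_mono) auto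
  then show ?thesis using B(1) by simp
qed

lemma genus1_prod_uniform_limit:
  "uniform_limit (cball 0 (1 / (2 * B))) (\<lambda>n z. \<Prod>j<n. genus1_factor (t j) z) genus1_prod sequentially"
proof -
  let ?D = "cball (0::complex) (1 / (2 * B))"
  have le: "norm (genus1_factor (t j) z - 1) \<le> 3 * (t j)\<^sup>2" if "z \<in> ?D" for j z
  proof -
    have z: "norm z \<le> 1 / (2 * B)" using that by simp
    have "1 / (2 * B) \<le> 1" using B(1) by simp
    then have "(norm z)\<^sup>2 \<le> 1" using z by (intro power_le_one) auto
    then have "(t j)\<^sup>2 * (norm z)\<^sup>2 \<le> (t j)\<^sup>2 * 1" by (intro mult_left_mono) auto
    with norm_genus1_factor_minus_one_le[OF norm_t_times_le[OF z], of j] show ?thesis by simp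
  qed
  have s: "summable (\<lambda>j. 3 * (t j)\<^sup>2)" by (intro summable_mult summable_sq)
  have "uniformly_convergent_on ?D (\<lambda>n z. \<Prod>j<n. genus1_factor (t j) z)"
  proof (rule uniformly_convergent_on_prod')
    show "continuous_on ?D (genus1_factor (t j))" for j
      unfolding genus1_factor_def by (intro continuous_intros)
    show "uniformly_convergent_on ?D (\<lambda>n z. \<Sum>j<n. norm (genus1_factor (t j) z - 1))"
      by (rule Weierstrass_m_test_ev[OF _ s, THEN uniformly_convergentI]) (use le in auto)
  qed simp
  then have ul: "uniform_limit ?D (\<lambda>n z. \<Prod>j<n. genus1_factor (t j) z)
      (\<lambda>z. lim (\<lambda>n. \<Prod>j<n. genus1_factor (t j) z)) sequentially"
    by (simp add: uniformly_convergent_uniform_limit_iff)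
  have "lim (\<lambda>n. \<Prod>j<n. genus1_factor (t j) z) = genus1_prod z" if z: "z \<in> ?D" for z
  proof (rule limI)
    have "summable (\<lambda>j. norm (genus1_factor (t j) z - 1))"
      by (rule summable_comparison_test[OF _ s]) (use le[OF z] in auto)
    then have "convergent_prod (\<lambda>j. genus1_factor (t j) z)"
      by (intro abs_convergent_prod_imp_convergent_prod) (simp add: abs_convergent_prod_conv_summable)
    from convergent_prod_LIMSEQ[OF this]
    show "(\<lambda>n. \<Prod>j<n. genus1_factor (t j) z) \<longlonglongrightarrow> genus1_prod z"
      by (simp add: genus1_prod_def LIMSEQ_lessThan_iff_atMost)
  qed
  then show ?thesis by (intro uniform_limit_cong'[THEN iffD1, OF _ _ ul]) auto
qed

text \<open>The partial products converge uniformly near \<open>0\<close>, hence so do their Taylor coefficients. Both the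
  differential equation and the preservation of real roots pass to coefficientwise limits.\<close>

lemma genus1_prod_fps:
  obtains g where "genus1_prod has_fps_expansion g"
    "neg_log_deriv g (Abs_fps (\<lambda>k. of_real (power_sum k)))" "preserves_real_roots g"
proof -
  define A where "A = ball (0::complex) (1 / (2 * B))"
  define p where "p n z = (\<Prod>j<n. genus1_factor (t j) z)" for n z
  define g where "g = fps_expansion genus1_prod 0"
  define h where "h n = (\<Prod>j<n. genus1_fps (t j))" for n
  have A: "open A" "0 \<in> A" using B(1) by (auto simp: A_def)
  have hol: "p n holomorphic_on A" for n
    unfolding p_def genus1_factor_def by (intro holomorphic_intros)
  have ul: "uniform_limit A p genus1_prod sequentially"
    using genus1_prod_uniform_limit unfolding p_def A_def
    by (rule uniform_limit_on_subset) auto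
  have "genus1_prod holomorphic_on A"
  proof (rule holomorphic_uniform_sequence[OF A(1) hol])
    fix z assume "z \<in> A"
    then obtain e where e: "e > 0" "cball z e \<subseteq> A" using A(1) by (meson open_contains_cball)
    with uniform_limit_on_subset[OF ul]
    show "\<exists>d>0. cball z d \<subseteq> A \<and> uniform_limit (cball z d) p genus1_prod sequentially" by blast
  qed
  then have exp: "genus1_prod has_fps_expansion g"
    unfolding g_def using A by (intro has_fps_expansion_fps_expansion[of A]) auto
  have "p n has_fps_expansion h n" for n
    unfolding p_def h_def by (intro fps_expansion_intros genus1_factor_has_fps_expansion)
  then have h_nth: "fps_nth (h n) k = (deriv ^^ k) (p n) 0 / fact k" for n k
    by (rule fps_nth_fps_expansion)
  have lim: "(\<lambda>n. fps_nth (h n) k) \<longlonglongrightarrow> fps_nth g k" for k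
    unfolding h_nth fps_nth_fps_expansion[OF exp]
    by (intro tendsto_intros higher_deriv_complex_uniform_limit[OF ul _ _ A]) (use hol in auto)
  have "neg_log_deriv g (Abs_fps (\<lambda>k. of_real (power_sum k)))"
  proof (rule neg_log_deriv_limit[OF _ lim])
    show "neg_log_deriv (h n) (\<Sum>j<n. Abs_fps (\<lambda>k. if k = 0 then 0 else of_real (t j ^ (k + 1))))" for n
      unfolding h_def by (intro neg_log_deriv_prod neg_log_deriv_genus1)
    fix k
    have "(\<lambda>n. \<Sum>j<n. if k = 0 then 0 else t j ^ (k + 1)) \<longlonglongrightarrow> power_sum k"
      unfolding power_sum_def by (rule summable_LIMSEQ[OF summable_power])
    then have "(\<lambda>n. complex_of_real (\<Sum>j<n. if k = 0 then 0 else t j ^ (k + 1))) \<longlonglongrightarrow> of_real (power_sum k)"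
      by (rule tendsto_of_real)
    then show "(\<lambda>n. fps_nth (\<Sum>j<n. Abs_fps (\<lambda>k. if k = 0 then 0 else complex_of_real (t j ^ (k + 1)))) k)
        \<longlonglongrightarrow> fps_nth (Abs_fps (\<lambda>k. of_real (power_sum k))) k"
      by (cases "k = 0") (simp_all add: fps_sum_nth)
  qed
  moreover have "preserves_real_roots g"
  proof (rule preserves_real_roots_limit[OF _ lim])
    show "preserves_real_roots (h n)" for n
      unfolding h_def genus1_fps_def
      by (intro preserves_real_roots_prod preserves_real_roots_mult preserves_real_roots_linear
          preserves_real_roots_exp)
  qed
  ultimately show ?thesis using that exp by blast
qed

text \<open>Expand every summand as a geometric series and interchange the two summations.\<close>

lemma power_sum_series:
  fixes z :: complex
  assumes z: "norm z \<le> 1 / (8 * B)"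
  shows "(\<lambda>j. of_real ((t j)\<^sup>2) * z / (1 - of_real (t j) * z)) sums (\<Sum>k. of_real (power_sum k) * z ^ k)"
    "summable (\<lambda>j. norm (of_real ((t j)\<^sup>2) * z / (1 - of_real (t j) * z)))"
proof -
  define a where "a k j = (if k = 0 then 0 else of_real (t j ^ (k + 1)) * z ^ k)" for k j
  have tz: "norm (of_real (t j) * z) \<le> 1 / 8" for j
  proof -
    have "norm (of_real (t j) * z) \<le> B * (1 / (8 * B))"
      unfolding norm_mult norm_of_real using z B(2)[of j] B(1) by (intro mult_mono) auto
    then show ?thesis using B(1) by simp
  qed
  have z1: "norm z \<le> 1" 
  proof -
    have "1 / (8 * B) \<le> 1" using B(1) by simp
    with z show ?thesis by linarith
  qed
  have a_le: "norm (a k j) \<le> 8 * (1/8) ^ k * (t j)\<^sup>2" for k j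
  proof (cases k)
    case (Suc i)
    have "a k j = of_real ((t j)\<^sup>2) * z * (of_real (t j) * z) ^ i"
      by (simp add: a_def Suc power2_eq_square power_mult_distrib)
    then have "norm (a k j) = (t j)\<^sup>2 * norm z * norm (of_real (t j) * z) ^ i"
      by (simp only: norm_mult norm_power norm_of_real) simp
    also have "\<dots> \<le> (t j)\<^sup>2 * 1 * (1/8) ^ i"
      by (rule mult_mono[OF mult_left_mono[OF z1] power_mono[OF tz]]) auto
    finally show ?thesis by (simp add: Suc mult.commute)
  qed (simp add: a_def)
  have sj: "summable (\<lambda>j. norm (a k j))" for k
    by (rule summable_comparison_test[OF _ summable_mult[OF summable_sq, of "8 * (1/8) ^ k"]])
       (use a_le in auto)
  have sk: "summable (\<lambda>k. norm (a k j))" for j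
  proof (rule summable_comparison_test)
    show "summable (\<lambda>k. 8 * (1/8) ^ k * (t j)\<^sup>2)"
      by (intro summable_mult2 summable_mult summable_geometric) simp
  qed (use a_le in auto)
  have sum_k: "(\<Sum>k. a k j) = of_real ((t j)\<^sup>2) * z / (1 - of_real (t j) * z)" for j
  proof -
    have lt: "norm (of_real (t j) * z) < 1" using tz[of j] by linarith
    have "(\<lambda>i. of_real ((t j)\<^sup>2) * z * (of_real (t j) * z) ^ i) sums
        (of_real ((t j)\<^sup>2) * z * (1 / (1 - of_real (t j) * z)))"
      by (intro sums_mult geometric_sums lt)
    moreover have "a (Suc i) j = of_real ((t j)\<^sup>2) * z * (of_real (t j) * z) ^ i" for i
      by (simp add: a_def power2_eq_square power_mult_distrib)
    ultimately have "(\<lambda>i. a (Suc i) j) sums (of_real ((t j)\<^sup>2) * z / (1 - of_real (t j) * z))" by simp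
    then have "(\<lambda>k. a k j) sums (of_real ((t j)\<^sup>2) * z / (1 - of_real (t j) * z))"
      by (subst (asm) sums_Suc_iff) (simp add: a_def)
    then show ?thesis by (rule sums_unique[symmetric])
  qed
  let ?M = "count_space (UNIV :: nat set)"
  have int: "integrable ?M (a k)" for k
    using sj by (simp add: integrable_count_space_nat_iff)
  have AE: "AE j in ?M. summable (\<lambda>k. norm (a k j))" using sk by simp
  have snorm: "summable (\<lambda>k. LINT j|?M. norm (a k j))"
  proof (rule summable_comparison_test)
    show "\<exists>N. \<forall>k\<ge>N. norm (LINT j|?M. norm (a k j)) \<le> 8 * (1/8) ^ k * (\<Sum>j. (t j)\<^sup>2)"
    proof (intro exI allI impI)
      fix k
      have "(LINT j|?M. norm (a k j)) = (\<Sum>j. norm (a k j))"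
        using sj by (intro integral_count_space_nat) (simp add: integrable_count_space_nat_iff)
      also have "\<dots> \<le> (\<Sum>j. 8 * (1/8) ^ k * (t j)\<^sup>2)"
        by (intro suminf_le a_le sj summable_mult summable_sq)
      also have "\<dots> = 8 * (1/8) ^ k * (\<Sum>j. (t j)\<^sup>2)" by (rule suminf_mult[OF summable_sq])
      finally show "norm (LINT j|?M. norm (a k j)) \<le> 8 * (1/8) ^ k * (\<Sum>j. (t j)\<^sup>2)" by simp
    qed
    show "summable (\<lambda>k. 8 * (1/8) ^ k * (\<Sum>j. (t j)\<^sup>2))"
      by (intro summable_mult2 summable_mult summable_geometric) simp
  qed
  have "integrable ?M (\<lambda>j. \<Sum>k. a k j)" by (rule integrable_suminf[OF int AE snorm])
  then have int': "integrable ?M (\<lambda>j. of_real ((t j)\<^sup>2) * z / (1 - of_real (t j) * z))"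
    unfolding sum_k .
  then show sn: "summable (\<lambda>j. norm (of_real ((t j)\<^sup>2) * z / (1 - of_real (t j) * z)))"
    by (simp add: integrable_count_space_nat_iff)
  have sum_j: "(\<Sum>j. a k j) = of_real (power_sum k) * z ^ k" for k
  proof -
    have "(\<lambda>j. of_real (if k = 0 then 0 else t j ^ (k + 1)) * z ^ k) sums (of_real (power_sum k) * z ^ k)"
      unfolding power_sum_def by (intro sums_mult2 sums_of_real summable_sums summable_power)
    moreover have "of_real (if k = 0 then 0 else t j ^ (k + 1)) * z ^ k = a k j" for j
      by (simp add: a_def)
    ultimately have "a k sums (of_real (power_sum k) * z ^ k)" by simp
    then show ?thesis by (rule sums_unique[symmetric])
  qed
  have "(\<Sum>j. of_real ((t j)\<^sup>2) * z / (1 - of_real (t j) * z)) = (LINT j|?M. (\<Sum>k. a k j))"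
    unfolding sum_k by (rule integral_count_space_nat[OF int', symmetric])
  also have "\<dots> = (\<Sum>k. LINT j|?M. a k j)" by (rule integral_suminf[OF int AE snorm])
  also have "\<dots> = (\<Sum>k. \<Sum>j. a k j)" by (simp add: integral_count_space_nat[OF int])
  also have "\<dots> = (\<Sum>k. of_real (power_sum k) * z ^ k)" unfolding sum_j ..
  finally have "(\<Sum>j. of_real ((t j)\<^sup>2) * z / (1 - of_real (t j) * z)) = (\<Sum>k. of_real (power_sum k) * z ^ k)" .
  with sn show "(\<lambda>j. of_real ((t j)\<^sup>2) * z / (1 - of_real (t j) * z)) sums (\<Sum>k. of_real (power_sum k) * z ^ k)"
    using summable_sums[OF summable_norm_cancel[OF sn]] by simp
qed

end

section \<open>Convergence of the root measures\<close>

lemma gauss_has_fps_expansion: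
  "(\<lambda>z. exp (- s * z\<^sup>2)) has_fps_expansion (fps_exp 1 oo (fps_const (- s) * fps_X\<^sup>2))"
  for s :: complex
proof -
  have "(\<lambda>z. - s * z\<^sup>2) has_fps_expansion (fps_const (- s) * fps_X\<^sup>2)"
    by (intro fps_expansion_intros)
  from has_fps_expansion_compose[OF has_fps_expansion_exp1 this] show ?thesis
    by (simp add: o_def)
qed

theorem theorem2p1:
  fixes c \<sigma> :: real and N :: enat and x :: "nat \<Rightarrow> real"
  assumes "\<forall>j\<in>index_set N. x j \<noteq> 0"
    and "(\<lambda>j. 1 / (x j)\<^sup>2) summable_on index_set N"
  shows "\<exists>\<mu>. freely_infinitely_divisible \<mu> \<and>
    has_R_transform \<mu> (\<lambda>z. of_real (drift c N x) + of_real (\<sigma>\<^sup>2) * z +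
      (LINT t|reciprocal_measure N x.
         (z + of_real t) / (1 - z * of_real t) * of_real (t\<^sup>2 / (t\<^sup>2 + 1)))) \<and>
    weak_conv_m (\<lambda>d. empirical_root_measure (A_hat (lp_function c \<sigma> N x) d)) \<mu>"
proof -
  let ?I = "index_set N"
  \<comment> \<open>Padding by \<open>0\<close> turns the product and sums over the index set into ones over all natural numbers,
    whether or not \<open>N\<close> is finite: the factor for \<open>0\<close> is \<open>1\<close> and its summands vanish.\<close>
  define t where "t j = (if j \<in> ?I then 1 / x j else 0)" for j
  have "(\<lambda>j. (t j)\<^sup>2) summable_on UNIV \<longleftrightarrow> (\<lambda>j. 1 / (x j)\<^sup>2) summable_on ?I"
    by (rule summable_on_cong_neutral) (auto simp: t_def power_divide)
  then have "summable (\<lambda>j. (t j)\<^sup>2)"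
    using assms(2) by (simp add: summable_on_UNIV_nonneg_real_iff)
  then interpret t: square_summable t by unfold_locales
  obtain g where g: "t.genus1_prod has_fps_expansion g"
    "neg_log_deriv g (Abs_fps (\<lambda>k. of_real (t.power_sum k)))" "preserves_real_roots g"
    by (rule t.genus1_prod_fps)
  define E where "E = fps_exp (complex_of_real c) * (fps_exp 1 oo (fps_const (- of_real (\<sigma>\<^sup>2 / 2)) * fps_X\<^sup>2))"
  define h where "h = E * g"
  define R where "R = fps_const (- of_real c) + fps_const (2 * of_real (\<sigma>\<^sup>2 / 2)) * fps_X
     + Abs_fps (\<lambda>k. complex_of_real (t.power_sum k))"
  define f where "f = lp_function c \<sigma> N x"
  have h_log: "neg_log_deriv h R"
    unfolding h_def E_def R_def
    by (intro neg_log_deriv_mult neg_log_deriv_exp neg_log_deriv_gauss g)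
  have h_pres: "preserves_real_roots h"
    unfolding h_def E_def
    by (intro preserves_real_roots_mult preserves_real_roots_exp preserves_real_roots_gauss g) simp
  have f_eq: "f z = exp (of_real c * z) * exp (- of_real (\<sigma>\<^sup>2 / 2) * z\<^sup>2) * t.genus1_prod z" for z
  proof -
    have "(if j \<in> ?I then (1 - z / of_real (x j)) * exp (z / of_real (x j)) else 1) = genus1_factor (t j) z" for j
      by (simp add: genus1_factor_def t_def)
    moreover have "exp (of_real c * z - of_real (\<sigma>\<^sup>2 / 2) * z\<^sup>2)
        = exp (of_real c * z) * exp (- of_real (\<sigma>\<^sup>2 / 2) * z\<^sup>2)"
      unfolding exp_add[symmetric] by simp
    ultimately show ?thesis by (simp only: f_def lp_function_def t.genus1_prod_def)
  qed
  have "f has_fps_expansion h"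
    unfolding f_eq h_def E_def
    by (intro has_fps_expansion_mult has_fps_expansion_exp gauss_has_fps_expansion g)
  then have h_eq: "fps_expansion f 0 = h" by (simp add: fps_expansion_eqI)
  \<comment> \<open>These choices bound the coefficients of \<open>R\<close> by \<open>C B\<^sup>j\<close> and leave room for the numerical
    conditions \<open>B \<epsilon> \<le> 1/8\<close> and \<open>8 C \<epsilon> \<le> 1\<close> of the contraction argument.\<close>
  define B where "B = t.B"
  define C where "C = \<bar>c\<bar> + \<sigma>\<^sup>2 + (\<Sum>j. (t j)\<^sup>2)"
  define \<epsilon> where "\<epsilon> = 1 / (8 * (B + C))"
  have B: "B \<ge> 1" using t.B by (simp add: B_def)
  have C: "C \<ge> 0" by (simp add: C_def suminf_nonneg[OF t.summable_sq])
  have R_bound: "norm (fps_nth R j) \<le> C * B ^ j" for j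
  proof -
    define u where "u = (if j = 0 then - c else if j = 1 then \<sigma>\<^sup>2 else 0)"
    have "fps_nth R j = of_real (u + t.power_sum j)"
      by (auto simp: R_def u_def)
    then have "norm (fps_nth R j) = \<bar>u + t.power_sum j\<bar>" by (simp only: norm_of_real)
    also have "\<dots> \<le> \<bar>u\<bar> * 1 + \<bar>t.power_sum j\<bar>" by simp
    also have "\<dots> \<le> (\<bar>c\<bar> + \<sigma>\<^sup>2) * B ^ j + (\<Sum>j. (t j)\<^sup>2) * B ^ j"
      using t.power_sum_bound[of j] one_le_power[OF B, of j]
      by (intro add_mono mult_mono) (auto simp: u_def B_def)
    finally show ?thesis by (simp add: C_def algebra_simps)
  qed
  interpret R: small_series "fps_nth R" C B \<epsilon>
  proof unfold_locales
    show "0 < \<epsilon>" "\<epsilon> \<le> 1" "B * \<epsilon> \<le> 1 / 8" "8 * C * \<epsilon> \<le> 1"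
      using B C by (auto simp: \<epsilon>_def field_simps)
  qed (use R_bound B C in auto)
  obtain \<mu> where \<mu>: "R.solves_fixpoint 1 \<mu>"
    "weak_conv_m (\<lambda>l. empirical_root_measure ((diff_op h (Suc l) ^^ Suc l) (monom 1 (Suc l)))) \<mu>"
    using R.exists_weak_limit[OF h_log refl h_pres, of 1 1] by (auto simp del: funpow.simps)
  have "weak_conv_m (\<lambda>l. empirical_root_measure (A_hat f (Suc l))) \<mu>"
    using \<mu>(2) by (simp add: A_hat_def h_eq del: funpow.simps)
  then have "weak_conv_m (\<lambda>d. empirical_root_measure (A_hat f d)) \<mu>"
    unfolding weak_conv_m_def weak_conv_def
    using LIMSEQ_imp_Suc[of "\<lambda>d. cdf (empirical_root_measure (A_hat f d)) _"] by simp
  moreover have "freely_infinitely_divisible \<mu>"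
    by (rule R.freely_infinitely_divisible_solves_fixpoint[OF h_log refl h_pres \<mu>(1)])
  moreover have "has_R_transform \<mu> (\<lambda>z. of_real (drift c N x) + of_real (\<sigma>\<^sup>2) * z +
      (LINT t|reciprocal_measure N x.
         (z + of_real t) / (1 - z * of_real t) * of_real (t\<^sup>2 / (t\<^sup>2 + 1))))"
  proof (rule R.has_R_transform_solves_fixpoint[OF \<mu>(1)])
    fix z :: complex assume z: "norm z \<le> \<epsilon>"
    have "\<epsilon> \<le> 1 / (8 * B)" using B C unfolding \<epsilon>_def by (intro divide_left_mono) auto
    then have z': "norm z \<le> 1 / (8 * t.B)" using z by (simp add: B_def)
    define \<phi> where "\<phi> s = (z + of_real s) / (1 - z * of_real s) * complex_of_real (s\<^sup>2 / (s\<^sup>2 + 1))" for s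
    define \<psi> where "\<psi> s = s ^ 3 / (s\<^sup>2 + 1)" for s :: real
    define \<xi> where "\<xi> j = of_real ((t j)\<^sup>2) * z / (1 - of_real (t j) * z)" for j
    have sums_\<xi>: "\<xi> sums (\<Sum>k. of_real (t.power_sum k) * z ^ k)" "summable (\<lambda>j. norm (\<xi> j))"
      unfolding \<xi>_def using t.power_sum_series[OF z'] .
    \<comment> \<open>The first part sums to the constant that the drift compensates; the second is a summand of \<open>R\<close>.\<close>
    have split: "\<phi> (t j) = of_real (\<psi> (t j)) + \<xi> j" for j
    proof -
      have "norm (of_real (t j) * z) \<le> 1 / 2"
        using t.norm_t_times_le[of z j] z' t.B(1) by (simp add: field_simps)
      then have ne: "1 - of_real (t j) * z \<noteq> 0" by auto
      have "(t j)\<^sup>2 + 1 > 0" by (simp add: add_nonneg_pos)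
      then have "complex_of_real ((t j)\<^sup>2 + 1) \<noteq> 0" unfolding of_real_eq_0_iff by linarith
      then have ne2: "(of_real (t j))\<^sup>2 + 1 \<noteq> (0::complex)" by simp
      show ?thesis
        using ne ne2 unfolding \<phi>_def \<psi>_def \<xi>_def
        by (simp add: field_simps power2_eq_square power3_eq_cube)
    qed
    have summable_\<psi>: "summable (\<lambda>j. norm (\<psi> (t j)))"
    proof (rule summable_comparison_test[OF _ summable_mult[OF t.summable_sq, of B]], intro exI allI impI)
      fix j
      have "norm (\<psi> (t j)) = \<bar>t j\<bar> * (t j)\<^sup>2 / ((t j)\<^sup>2 + 1)"
        by (simp add: \<psi>_def abs_mult power3_eq_cube power2_eq_square abs_of_pos add_nonneg_pos)
      also have "\<dots> \<le> \<bar>t j\<bar> * (t j)\<^sup>2 / 1" by (intro divide_left_mono) (auto simp: add_nonneg_pos)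
      also have "\<dots> \<le> B * (t j)\<^sup>2" using t.B by (auto simp: B_def intro!: mult_right_mono)
      finally show "norm (norm (\<psi> (t j))) \<le> B * (t j)\<^sup>2" by simp
    qed
    have drift: "drift c N x = - c - (\<Sum>j. \<psi> (t j))"
    proof -
      have "((\<lambda>j. \<psi> (t j)) has_sum (\<Sum>j. \<psi> (t j))) UNIV"
        by (rule norm_summable_imp_has_sum[OF summable_\<psi> summable_sums[OF summable_norm_cancel[OF summable_\<psi>]]])
      also have "?this \<longleftrightarrow> ((\<lambda>j. 1 / (x j ^ 3 + x j)) has_sum (\<Sum>j. \<psi> (t j))) ?I"
      proof (rule has_sum_cong_neutral)
        fix j assume "j \<in> UNIV \<inter> ?I"
        then have nz: "x j \<noteq> 0" and tj: "t j = 1 / x j" using assms(1) by (auto simp: t_def)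
        have "(t j)\<^sup>2 + 1 = ((x j)\<^sup>2 + 1) / (x j)\<^sup>2"
          using nz by (simp add: tj power_divide add_divide_distrib)
        then have "\<psi> (t j) = (x j)\<^sup>2 / (x j ^ 3 * ((x j)\<^sup>2 + 1))"
          unfolding \<psi>_def by (simp add: tj power_divide)
        also have "\<dots> = 1 / (x j * ((x j)\<^sup>2 + 1))"
          using nz by (simp add: power3_eq_cube power2_eq_square)
        also have "x j * ((x j)\<^sup>2 + 1) = x j ^ 3 + x j"
          by (simp add: algebra_simps power3_eq_cube power2_eq_square)
        finally show "\<psi> (t j) = 1 / (x j ^ 3 + x j)" .
      qed (auto simp: t_def \<psi>_def)
      finally show ?thesis unfolding drift_def by (simp add: infsumI)
    qed
    have "(LINT s|reciprocal_measure N x. \<phi> s) = (LINT j|count_space ?I. \<phi> (1 / x j))"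
      unfolding reciprocal_measure_def by (rule integral_distr) (auto simp: \<phi>_def)
    also have "\<dots> = (LINT j|restrict_space (count_space UNIV) ?I. \<phi> (1 / x j))"
      by (simp add: restrict_count_space)
    also have "\<dots> = (LINT j|count_space UNIV. indicator ?I j *\<^sub>R \<phi> (1 / x j))"
      by (rule integral_restrict_space) auto
    also have "\<dots> = (LINT j|count_space UNIV. \<phi> (t j))"
      by (intro Bochner_Integration.integral_cong) (auto simp: t_def \<phi>_def indicator_def)
    also have "\<dots> = (\<Sum>j. \<phi> (t j))"
    proof (rule integral_count_space_nat)
      have "summable (\<lambda>j. norm (\<psi> (t j)) + norm (\<xi> j))" by (intro summable_add summable_\<psi> sums_\<xi>)
      then have "summable (\<lambda>j. norm (\<phi> (t j)))"
      proof (rule summable_comparison_test[rotated], intro exI allI impI)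
        show "norm (norm (\<phi> (t j))) \<le> norm (\<psi> (t j)) + norm (\<xi> j)" for j
          using norm_triangle_ineq[of "of_real (\<psi> (t j))" "\<xi> j"] by (simp add: split)
      qed
      then show "integrable (count_space UNIV) (\<lambda>j. \<phi> (t j))" by (simp add: integrable_count_space_nat_iff)
    qed
    also have "\<dots> = of_real (\<Sum>j. \<psi> (t j)) + (\<Sum>k. of_real (t.power_sum k) * z ^ k)"
      unfolding split
      by (intro sums_unique[symmetric] sums_add sums_of_real sums_\<xi> summable_sums summable_norm_cancel[OF summable_\<psi>])
    finally have int: "(LINT s|reciprocal_measure N x. \<phi> s)
        = of_real (\<Sum>j. \<psi> (t j)) + (\<Sum>k. of_real (t.power_sum k) * z ^ k)" .
    have "R.Rf z = - of_real c + of_real (\<sigma>\<^sup>2) * z + (\<Sum>k. of_real (t.power_sum k) * z ^ k)"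
    proof -
      define q where "q k = fps_nth (fps_const (- of_real c) + fps_const (2 * complex_of_real (\<sigma>\<^sup>2 / 2)) * fps_X) k * z ^ k" for k
      have "q sums (\<Sum>k\<in>{0,1}. q k)" by (rule sums_finite) (auto simp: q_def)
      then have q: "q sums (- of_real c + of_real (\<sigma>\<^sup>2) * z)" by (simp add: q_def)
      have Rs: "(\<lambda>k. fps_nth R k * z ^ k) sums R.Rf z"
        unfolding R.Rf_def
        by (rule summable_sums[OF summable_norm_cancel[OF R.sum_term_le(1)]])
           (use z in \<open>auto simp: norm_power intro: power_mono\<close>)
      have "(\<lambda>k. fps_nth R k * z ^ k - q k) sums (R.Rf z - (- of_real c + of_real (\<sigma>\<^sup>2) * z))"
        by (rule sums_diff[OF Rs q])
      also have "(\<lambda>k. fps_nth R k * z ^ k - q k) = (\<lambda>k. of_real (t.power_sum k) * z ^ k)"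
        by (auto simp: R_def q_def algebra_simps)
      finally show ?thesis by (simp add: sums_iff)
    qed
    then show "of_real (drift c N x) + of_real (\<sigma>\<^sup>2) * z +
      (LINT t|reciprocal_measure N x.
         (z + of_real t) / (1 - z * of_real t) * of_real (t\<^sup>2 / (t\<^sup>2 + 1))) = of_real 1 * R.Rf z"
      using int unfolding \<phi>_def drift by simp
  qed auto
  ultimately show ?thesis unfolding f_def by blast
qed

end
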